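(* Let $S=K[t_1,\ldots,t_s]$ be a polynomial ring over a field $K$, let $I$ be an ideal of $S$ generated by monomials of degree $2$, with minimal set of monomial generators $\{t^{v_1},\ldots,t^{v_q}\}$, and let $A$ be the incidence matrix of $I$, i.e., the $s\times q$ matrix with columns $v_1,\ldots,v_q$. Let $$\mathcal{B}=\{e_{s+1}\}\cup\{e_i+e_{s+1}\}_{i=1}^s\cup\{(v_i,1)\}_{i=1}^q\subset\mathbb{R}^{s+1},\qquad \mathcal{Q}={\rm conv}(0,e_1,\ldots,e_s,v_1,\ldots,v_q)\subset\mathbb{R}^s.$$ Then $\overline{K[\mathbb{N}\mathcal{B}]}={\rm Er}(\mathcal{Q})$, and the equality $K[\mathbb{N}\mathcal{B}]={\rm Er}(\mathcal{Q})$ holds if and only if the linear system $x\geq 0;\, xA\leq 1$ has the integer rounding property.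
   Context: $\mathbb{N}=\{0,1,2,\ldots\}$; $t^a:=t_1^{a_1}\cdots t_s^{a_s}$ for $a\in\mathbb{N}^s$; $e_i$ is the $i$-th unit vector (of $\mathbb{R}^{s+1}$ in the definition of $\mathcal{B}$, of $\mathbb{R}^s$ in that of $\mathcal{Q}$). With $z=t_{s+1}$ a new variable, $K[\mathbb{N}\mathcal{B}]=K[z,t_1z,\ldots,t_sz,t^{v_1}z,\ldots,t^{v_q}z]\subset S[z]$ is the semigroup ring of $\mathbb{N}\mathcal{B}$, the semigroup of $\mathbb{N}$-combinations of $\mathcal{B}$, and $\overline{K[\mathbb{N}\mathcal{B}]}$ is its integral closure in its field of fractions. The Ehrhart ring of $\mathcal{Q}$ is ${\rm Er}(\mathcal{Q})=K[t^{\alpha}z^b\mid b\in\mathbb{N},\ \alpha\in\mathbb{Z}^s\cap b\mathcal{Q}]\subset S[z]$. The linear system $x\geq 0;\, xA\leq 1$ (with $1=(1,\ldots,1)$) has the integer rounding property if $$\lceil\min\{\langle y,1\rangle\mid y\geq 0;\, Ay\geq\alpha\}\rceil=\min\{\langle y,1\rangle\mid y\in\mathbb{N}^q;\, Ay\geq\alpha\}$$ for each integral vector $\alpha\in\mathbb{Z}^s$ for which the left-hand side is finite, where on the left $y$ ranges over real vectors in $\mathbb{R}^q$, $\langle\ ,\,\rangle$ is the ordinary inner product, and inequalities between vectors are entrywise. *)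

theory Defs
  imports
    "HOL-Analysis.Analysis"
    "HOL-Library.Poly_Mapping"
    "HOL-Computational_Algebra.Computational_Algebra"
begin

text \<open>
  The variables of \<open>S\<close> are indexed by a finite linearly ordered type \<open>'n\<close> (so \<open>s = CARD('n)\<close>);
  an exponent vector is an element of \<^typ>\<open>'n \<Rightarrow>\<^sub>0 nat\<close>.  The linear order is what the
  instance \<open>poly_mapping :: idom\<close> needs, hence also the fraction field of \<open>S[z]\<close>.
\<close>

type_synonym ('n, 'k) mpoly = "('n \<Rightarrow>\<^sub>0 nat) \<Rightarrow>\<^sub>0 'k"

definition mon :: "('n \<Rightarrow>\<^sub>0 nat) \<Rightarrow> ('n, 'k::field) mpoly" where
  "mon a = Poly_Mapping.single a 1"

definition monz :: "('n \<Rightarrow>\<^sub>0 nat) \<Rightarrow> nat \<Rightarrow> ('n, 'k::field) mpoly poly" where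
  "monz a b = Polynomial.monom (mon a) b"

definition vec_of :: "('n::finite \<Rightarrow>\<^sub>0 nat) \<Rightarrow> real ^ 'n" where
  "vec_of a = (\<chi> i. real (Poly_Mapping.lookup a i))"

definition total_degree :: "('n::finite \<Rightarrow>\<^sub>0 nat) \<Rightarrow> nat" where
  "total_degree a = (\<Sum>i\<in>UNIV. Poly_Mapping.lookup a i)"


subsection \<open>Monomial ideals\<close>

text \<open>The span of a set in a commutative ring regarded as a module over itself.\<close>

definition ideal_gen :: "'a::comm_ring_1 set \<Rightarrow> 'a set" where
  "ideal_gen G = module.span (*) G"

definition minimal_monomial_generators :: "('n, 'k::field) mpoly set \<Rightarrow> ('n, 'k) mpoly set \<Rightarrow> bool" where
  "minimal_monomial_generators I G \<longleftrightarrow>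
     G \<subseteq> range mon \<and> ideal_gen G = I \<and> (\<forall>H. H \<subset> G \<longrightarrow> ideal_gen H \<noteq> I)"

text \<open>The \<open>j\<close>-th column of the incidence matrix is \<open>v j\<close>, for \<open>j < q\<close>; later columns are unused.\<close>

definition incidence_matrix :: "(nat \<Rightarrow> ('n \<Rightarrow>\<^sub>0 nat)) \<Rightarrow> 'n \<Rightarrow> nat \<Rightarrow> int" where
  "incidence_matrix v i j = int (Poly_Mapping.lookup (v j) i)"


subsection \<open>Subrings of \<open>S[z]\<close>\<close>

definition K_subalgebra :: "('n, 'k::field) mpoly poly set \<Rightarrow> bool" where
  "K_subalgebra R \<longleftrightarrow>
     (\<forall>c. [:Poly_Mapping.single 0 c:] \<in> R) \<and>
     (\<forall>x\<in>R. \<forall>y\<in>R. x + y \<in> R \<and> x * y \<in> R)"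

text \<open>\<open>K[X]\<close> for a subset \<open>X\<close> of \<open>S[z]\<close>.\<close>

definition K_adjoin :: "('n, 'k::field) mpoly poly set \<Rightarrow> ('n, 'k) mpoly poly set" where
  "K_adjoin X = K_subalgebra hull X"

definition nat_combinations :: "'v::real_vector set \<Rightarrow> 'v set" where
  "nat_combinations B =
     {(\<Sum>b\<in>F. real (c b) *\<^sub>R b) | F (c :: 'v \<Rightarrow> nat). finite F \<and> F \<subseteq> B}"

text \<open>\<open>\<real>\<^sup>s\<^sup>+\<^sup>1\<close> is represented as \<^typ>\<open>(real ^ 'n) \<times> real\<close>, the last coordinate being the exponent of \<open>z\<close>.\<close>

definition \<B> :: "nat \<Rightarrow> (nat \<Rightarrow> ('n::finite \<Rightarrow>\<^sub>0 nat)) \<Rightarrow> ((real ^ 'n) \<times> real) set" where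
  "\<B> q v = {(0, 1)} \<union> {(axis i 1, 1) | i. True} \<union> {(vec_of (v j), 1) | j. j < q}"

definition \<Q> :: "nat \<Rightarrow> (nat \<Rightarrow> ('n::finite \<Rightarrow>\<^sub>0 nat)) \<Rightarrow> (real ^ 'n) set" where
  "\<Q> q v = convex hull ({0} \<union> {axis i 1 | i. True} \<union> {vec_of (v j) | j. j < q})"

definition semigroup_ring :: "((real ^ 'n) \<times> real) set \<Rightarrow> ('n::finite, 'k::field) mpoly poly set" where
  "semigroup_ring M = K_adjoin {monz a b | a b. (vec_of a, real b) \<in> M}"

text \<open>
  The exponents range over \<open>\<nat>\<^sup>s\<close> rather than \<open>\<int>\<^sup>s\<close>, which makes no difference for a polytope \<open>P\<close>
  in the nonnegative orthant such as \<open>\<Q> q v\<close>.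
\<close>

definition ehrhart_ring :: "(real ^ 'n) set \<Rightarrow> ('n::finite, 'k::field) mpoly poly set" where
  "ehrhart_ring P = K_adjoin {monz a b | a b. vec_of a \<in> (\<lambda>x. real b *\<^sub>R x) ` P}"


subsection \<open>Integral closure\<close>

text \<open>
  For a subring \<open>R\<close> of an integral domain, its field of fractions is taken inside the field of
  fractions of the ambient domain, where \<open>R\<close> itself appears as \<open>to_fract ` R\<close>.
\<close>

definition fraction_field_of :: "'a::idom set \<Rightarrow> 'a fract set" where
  "fraction_field_of R = {Fract a b | a b. a \<in> R \<and> b \<in> R \<and> b \<noteq> 0}"

definition integral_over :: "'a::comm_ring_1 set \<Rightarrow> 'a \<Rightarrow> bool" where
  "integral_over R x \<longleftrightarrow>
     (\<exists>p. lead_coeff p = 1 \<and> (\<forall>i. poly.coeff p i \<in> R) \<and> poly p x = 0)"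

definition integral_closure :: "'a::idom set \<Rightarrow> 'a fract set" where
  "integral_closure R = {x \<in> fraction_field_of R. integral_over (to_fract ` R) x}"


subsection \<open>Integer rounding property\<close>

text \<open>
  \<open>A\<close> is a matrix whose rows are indexed by \<open>'n\<close> and whose columns are indexed by \<open>0, \<dots>, q - 1\<close>;
  only the entries \<open>y j\<close> with \<open>j < q\<close> of a vector \<open>y\<close> matter.
\<close>

definition covers :: "nat \<Rightarrow> ('n \<Rightarrow> nat \<Rightarrow> int) \<Rightarrow> ('n \<Rightarrow> int) \<Rightarrow> (nat \<Rightarrow> real) \<Rightarrow> bool" where
  "covers q A \<alpha> y \<longleftrightarrow>
     (\<forall>j<q. 0 \<le> y j) \<and> (\<forall>i. real_of_int (\<alpha> i) \<le> (\<Sum>j<q. real_of_int (A i j) * y j))"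

definition real_values :: "nat \<Rightarrow> ('n \<Rightarrow> nat \<Rightarrow> int) \<Rightarrow> ('n \<Rightarrow> int) \<Rightarrow> real set" where
  "real_values q A \<alpha> = {(\<Sum>j<q. y j) | y. covers q A \<alpha> y}"

definition integer_values :: "nat \<Rightarrow> ('n \<Rightarrow> nat \<Rightarrow> int) \<Rightarrow> ('n \<Rightarrow> int) \<Rightarrow> nat set" where
  "integer_values q A \<alpha> = {(\<Sum>j<q. y j) | y. covers q A \<alpha> (\<lambda>j. real (y j))}"

text \<open>
  The premise says that the minimum of the real program exists.  The integer program is then
  feasible too when \<open>A\<close> is nonnegative (round up a real solution), so both \<open>LEAST\<close>s are minima.
\<close>

definition integer_rounding :: "nat \<Rightarrow> ('n \<Rightarrow> nat \<Rightarrow> int) \<Rightarrow> bool" where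
  "integer_rounding q A \<longleftrightarrow>
     (\<forall>\<alpha>. (\<exists>m\<in>real_values q A \<alpha>. \<forall>r\<in>real_values q A \<alpha>. m \<le> r) \<longrightarrow>
        \<lceil>LEAST r. r \<in> real_values q A \<alpha>\<rceil> = int (LEAST n. n \<in> integer_values q A \<alpha>))"

end

theory Submission
  imports "Jordan_Normal_Form.Char_Poly" Defs
begin

text \<open>
  Every ring in the statement is spanned over \<open>K\<close> by the monomials \<open>t\<^sup>a z\<^sup>b\<close> whose exponent \<open>(a, b)\<close>
  lies in a submonoid of \<open>\<nat>\<^sup>s \<times> \<nat>\<close>.  For \<open>K[\<nat>\<B>]\<close> this monoid consists of the natural combinations of the
  generators \<open>(a, 1)\<close>, for the Ehrhart ring it consists of the lattice points of the real cone over
  \<open>\<Q> \<times> {1}\<close>, which is the cone that the same generators span.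

  The description of the integral closure holds for the convex hull of any finite set of exponents that
  contains \<open>0\<close> and the units \<open>e\<^sub>i\<close> (\<open>integral_closure_height_one_monoid_ring\<close>).  Rounding the
  coefficients of a lattice point of the cone down to integers leaves a lattice point of bounded
  height (\<open>ehrhart_exponents_decompose\<close>).  So the Ehrhart ring is a finitely generated
  \<open>K[\<nat>\<B>]\<close>-module, and the Cayley-Hamilton argument makes its elements integral
  (\<open>integral_over_finite_module\<close>).  They lie in the field of fractions of \<open>K[\<nat>\<B>]\<close>, because
  a power of \<open>z\<close> moves any polynomial into \<open>K[\<nat>\<B>]\<close>.

  Conversely, an integral fraction \<open>f / g\<close> has a common denominator \<open>d\<close> for all its powers.
  Comparing leading exponents in \<open>d f\<^sup>k = g\<^sup>k h\<^sub>k\<close> shows that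
  \<open>lead d + k (lead f - lead g)\<close> is in the cone for every \<open>k\<close>; dividing by \<open>k\<close>, and since the cone is
  closed, \<open>lead f - lead g\<close> is in the cone too.  Hence the leading term of \<open>f\<close> can be cancelled by a
  multiple of \<open>g\<close> in the Ehrhart ring.  The fraction keeps its common denominator, and after finitely
  many such steps \<open>g\<close> divides \<open>f\<close> (\<open>monoid_ring_completely_closed\<close>).

  The rings are equal iff the two monoids are.  By minimality the \<open>v\<^sub>j\<close> are among
  the given generators of degree \<open>2\<close>.  Degree \<open>2\<close> makes the set
  \<open>{0, e\<^sub>1, \<dots>, e\<^sub>s, v\<^sub>1, \<dots>, v\<^sub>q}\<close> closed downwards, and both monoids inherit this: a vector below an
  integral, respectively real, combination of the \<open>v\<^sub>j\<close> belongs to the monoid at the height given by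
  the sum of the coefficients.  In the other direction a summand \<open>e\<^sub>i\<close> may be replaced by some \<open>v\<^sub>j\<close>
  with \<open>e\<^sub>i \<le> v\<^sub>j\<close> if what counts is only to dominate a vector (\<open>absorb_units\<close>).  So, apart from
  the coordinates that no \<open>v\<^sub>j\<close> involves and in which all coefficients are integers anyway, \<open>(a, b)\<close>
  is in the cone iff the minimum of the real program for \<open>a\<close> is at most \<open>b\<close>, and in \<open>\<nat>\<B>\<close> iff the
  minimum of the integer program is at most \<open>b\<close>.  The equality of the monoids then says that the
  integer minimum is the real one rounded up.
\<close>

section \<open>Subrings\<close>

definition is_subring :: "'a::comm_ring_1 set \<Rightarrow> bool" where
  "is_subring R \<longleftrightarrow> 1 \<in> R \<and> (\<forall>x\<in>R. \<forall>y\<in>R. x - y \<in> R \<and> x * y \<in> R)"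

lemma is_subring_closed:
  assumes "is_subring R"
  shows is_subring_1: "1 \<in> R" and is_subring_0: "0 \<in> R"
    and is_subring_diff: "\<And>x y. x \<in> R \<Longrightarrow> y \<in> R \<Longrightarrow> x - y \<in> R"
    and is_subring_mult: "\<And>x y. x \<in> R \<Longrightarrow> y \<in> R \<Longrightarrow> x * y \<in> R"
    and is_subring_uminus: "\<And>x. x \<in> R \<Longrightarrow> - x \<in> R"
    and is_subring_add: "\<And>x y. x \<in> R \<Longrightarrow> y \<in> R \<Longrightarrow> x + y \<in> R"
proof -
  show 1: "1 \<in> R" and d: "\<And>x y. x \<in> R \<Longrightarrow> y \<in> R \<Longrightarrow> x - y \<in> R"
    and "\<And>x y. x \<in> R \<Longrightarrow> y \<in> R \<Longrightarrow> x * y \<in> R"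
    using assms by (auto simp: is_subring_def)
  show 0: "0 \<in> R" using d[OF 1 1] by simp
  show u: "\<And>x. x \<in> R \<Longrightarrow> - x \<in> R" using d[OF 0] by simp
  show "\<And>x y. x \<in> R \<Longrightarrow> y \<in> R \<Longrightarrow> x + y \<in> R" using d[OF _ u] by fastforce
qed

lemma is_subring_sum: "is_subring R \<Longrightarrow> (\<And>i. i \<in> A \<Longrightarrow> f i \<in> R) \<Longrightarrow> sum f A \<in> R"
  by (induction A rule: infinite_finite_induct) (auto intro: is_subring_0 is_subring_add)

lemma is_subring_prod: "is_subring R \<Longrightarrow> (\<And>i. i \<in> A \<Longrightarrow> f i \<in> R) \<Longrightarrow> prod f A \<in> R"
  by (induction A rule: infinite_finite_induct) (auto intro: is_subring_1 is_subring_mult)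

lemma is_subring_power: "is_subring R \<Longrightarrow> x \<in> R \<Longrightarrow> x ^ n \<in> R"
  by (induction n) (auto intro: is_subring_1 is_subring_mult)

lemma is_subring_of_nat: "is_subring R \<Longrightarrow> of_nat n \<in> R"
  by (induction n) (auto intro: is_subring_0 is_subring_1 is_subring_add)

section \<open>Supports and monoid rings\<close>

definition supp :: "('n, 'k::field) mpoly poly \<Rightarrow> (('n \<Rightarrow>\<^sub>0 nat) \<times> nat) set" where
  "supp f = {(a, b). Poly_Mapping.lookup (poly.coeff f b) a \<noteq> 0}"

definition monoid_ring :: "(('n \<Rightarrow>\<^sub>0 nat) \<times> nat) set \<Rightarrow> ('n, 'k::field) mpoly poly set" where
  "monoid_ring M = {f. supp f \<subseteq> M}"

definition add_submonoid :: "'a::comm_monoid_add set \<Rightarrow> bool" where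
  "add_submonoid M \<longleftrightarrow> 0 \<in> M \<and> (\<forall>x\<in>M. \<forall>y\<in>M. x + y \<in> M)"

abbreviation const :: "'k::field \<Rightarrow> ('n, 'k) mpoly poly" where
  "const c \<equiv> [:Poly_Mapping.single 0 c:]"

lemma finite_supp: "finite (supp f)"
proof (rule finite_subset)
  show "supp f \<subseteq> (\<Union>b\<le>degree f. Poly_Mapping.keys (poly.coeff f b) \<times> {b})"
  proof safe
    fix a b assume "(a, b) \<in> supp f"
    then have a: "Poly_Mapping.lookup (poly.coeff f b) a \<noteq> 0" by (simp add: supp_def)
    then have "b \<le> degree f" by (intro le_degree) auto
    with a show "(a, b) \<in> (\<Union>b\<le>degree f. Poly_Mapping.keys (poly.coeff f b) \<times> {b})"
      by (simp add: in_keys_iff)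
  qed
qed auto

lemma supp_0 [simp]: "supp 0 = {}"
  by (simp add: supp_def)

lemma supp_diff: "supp (f - g) \<subseteq> supp f \<union> supp g"
  by (auto simp: supp_def lookup_minus)

lemma supp_mult: "supp (f * g) \<subseteq> {m + m' | m m'. m \<in> supp f \<and> m' \<in> supp g}"
proof safe
  fix a b assume "(a, b) \<in> supp (f * g)"
  then have "(\<Sum>i\<le>b. Poly_Mapping.lookup (poly.coeff f i * poly.coeff g (b - i)) a) \<noteq> 0"
    by (simp add: supp_def coeff_mult lookup_sum)
  then obtain i where i: "i \<le> b" "Poly_Mapping.lookup (poly.coeff f i * poly.coeff g (b - i)) a \<noteq> 0"
    by (metis (no_types, lifting) atMost_iff sum.neutral)
  then have "a \<in> Poly_Mapping.keys (poly.coeff f i * poly.coeff g (b - i))"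
    by (simp add: in_keys_iff)
  then obtain c d where "a = c + d" "c \<in> Poly_Mapping.keys (poly.coeff f i)"
      "d \<in> Poly_Mapping.keys (poly.coeff g (b - i))"
    using keys_mult by blast
  with i(1) show "\<exists>m m'. (a, b) = m + m' \<and> m \<in> supp f \<and> m' \<in> supp g"
    by (intro exI[of _ "(c, i)"] exI[of _ "(d, b - i)"]) (auto simp: supp_def in_keys_iff)
qed

lemma supp_monz: "supp (monz a b :: ('n, 'k::field) mpoly poly) = {(a, b)}"
  by (auto simp: supp_def monz_def mon_def lookup_single when_def split: if_splits)

lemma supp_const: "supp (const c :: ('n, 'k::field) mpoly poly) \<subseteq> {0}"
proof safe
  fix a b assume "(a, b) \<in> supp (const c :: ('n, 'k::field) mpoly poly)"
  then show "(a, b) = 0"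
    by (cases b) (auto simp: supp_def lookup_single when_def zero_prod_def split: if_splits)
qed

lemma const_mult_monz: "const c * monz a b = Polynomial.monom (Poly_Mapping.single a c) b"
  by (simp add: monz_def mon_def smult_monom mult_single)

lemma supp_monz_expansion:
  fixes f :: "('n, 'k::field) mpoly poly"
  shows "f = (\<Sum>(a, b)\<in>supp f. const (Poly_Mapping.lookup (poly.coeff f b) a) * monz a b)"
proof (intro poly_eqI poly_mapping_eqI)
  fix b a
  let ?g = "\<lambda>m. if m = (a, b) then Poly_Mapping.lookup (poly.coeff f b) a else 0"
  have "Poly_Mapping.lookup (poly.coeff (\<Sum>(a, b)\<in>supp f. const (Poly_Mapping.lookup (poly.coeff f b) a) * monz a b) b) a
      = (\<Sum>m\<in>supp f. ?g m)"
    unfolding const_mult_monz coeff_sum lookup_sum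
    by (intro sum.cong refl) (auto simp: lookup_single when_def split: if_splits)
  also have "\<dots> = Poly_Mapping.lookup (poly.coeff f b) a"
    by (subst sum.delta[OF finite_supp]) (auto simp: supp_def)
  finally show "Poly_Mapping.lookup (poly.coeff f b) a =
    Poly_Mapping.lookup (poly.coeff (\<Sum>(a, b)\<in>supp f. const (Poly_Mapping.lookup (poly.coeff f b) a) * monz a b) b) a"
    by simp
qed

lemma monz_in_monoid_ring_iff: "monz a b \<in> monoid_ring M \<longleftrightarrow> (a, b) \<in> M"
  by (simp add: monoid_ring_def supp_monz)

lemma monoid_ring_eq_iff:
  "(monoid_ring M :: ('n, 'k::field) mpoly poly set) = monoid_ring N \<longleftrightarrow> M = N"
proof
  assume "(monoid_ring M :: ('n, 'k) mpoly poly set) = monoid_ring N"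
  then have "\<And>a b. (monz a b :: ('n, 'k) mpoly poly) \<in> monoid_ring M \<longleftrightarrow> (monz a b :: ('n, 'k) mpoly poly) \<in> monoid_ring N"
    by simp
  then show "M = N" unfolding monz_in_monoid_ring_iff by auto
qed simp

context
  fixes M :: "(('n \<Rightarrow>\<^sub>0 nat) \<times> nat) set"
  assumes M: "add_submonoid M"
begin

lemma const_in_monoid_ring: "const c \<in> monoid_ring M"
  using supp_const M unfolding monoid_ring_def add_submonoid_def by fastforce

lemma is_subring_monoid_ring: "is_subring (monoid_ring M :: ('n, 'k::field) mpoly poly set)"
  unfolding is_subring_def
proof (intro conjI ballI)
  show "(1 :: ('n, 'k) mpoly poly) \<in> monoid_ring M"
    using const_in_monoid_ring[of 1] by (simp add: one_pCons)
next
  fix x y :: "('n, 'k) mpoly poly" assume xy: "x \<in> monoid_ring M" "y \<in> monoid_ring M"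
  then show "x - y \<in> monoid_ring M" using supp_diff[of x y] by (auto simp: monoid_ring_def)
  show "x * y \<in> monoid_ring M"
  proof -
    have "m \<in> M" if m: "m \<in> supp (x * y)" for m
    proof -
      obtain m1 m2 where "m = m1 + m2" "m1 \<in> supp x" "m2 \<in> supp y" using m supp_mult[of x y] by blast
      then show "m \<in> M" using xy M by (auto simp: monoid_ring_def add_submonoid_def)
    qed
    then show ?thesis by (auto simp: monoid_ring_def)
  qed
qed

text \<open>
  Since \<open>M\<close> is closed under addition, the \<open>K\<close>-span of its monomials is already closed under
  multiplication.
\<close>

lemma K_adjoin_monz_eq_monoid_ring:
  "K_adjoin {monz a b | a b. (a, b) \<in> M} = (monoid_ring M :: ('n, 'k::field) mpoly poly set)"
  unfolding K_adjoin_def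
proof (rule hull_unique)
  show "{monz a b | a b. (a, b) \<in> M} \<subseteq> (monoid_ring M :: ('n, 'k) mpoly poly set)"
    by (auto simp: monz_in_monoid_ring_iff)
  show "K_subalgebra (monoid_ring M :: ('n, 'k) mpoly poly set)"
    unfolding K_subalgebra_def using is_subring_closed[OF is_subring_monoid_ring] const_in_monoid_ring by auto
next
  fix R :: "('n, 'k) mpoly poly set"
  assume X: "{monz a b | a b. (a, b) \<in> M} \<subseteq> R" and R: "K_subalgebra R"
  have c: "const c \<in> R" for c using R by (auto simp: K_subalgebra_def)
  have z: "0 \<in> R" using c[of 0] by simp
  have R_sum: "sum h A \<in> R" if "\<And>i. i \<in> A \<Longrightarrow> h i \<in> R" for h :: "('n \<Rightarrow>\<^sub>0 nat) \<times> nat \<Rightarrow> _" and A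
    using that by (induction A rule: infinite_finite_induct) (use z R in \<open>auto simp: K_subalgebra_def\<close>)
  show "monoid_ring M \<subseteq> R"
  proof
    fix f :: "('n, 'k) mpoly poly" assume f: "f \<in> monoid_ring M"
    have "const c * monz a b \<in> R" if "(a, b) \<in> supp f" for a b c
    proof -
      have "monz a b \<in> R" using that f X unfolding monoid_ring_def by blast
      with c[of c] R show ?thesis unfolding K_subalgebra_def by blast
    qed
    then have "(\<Sum>(a, b)\<in>supp f. const (Poly_Mapping.lookup (poly.coeff f b) a) * monz a b) \<in> R"
      by (intro R_sum) (simp only: split_beta' prod.collapse)
    then show "f \<in> R" using supp_monz_expansion[of f] by simp
  qed
qed

end

section \<open>Leading exponents\<close>

text \<open>
  The leading exponent for the order that compares the exponents of \<open>z\<close> before those of the \<open>t\<^sub>i\<close>.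
  It is a compatible total order, so that leading exponents add under multiplication.
\<close>

definition lead :: "('n::linorder, 'k::field) mpoly poly \<Rightarrow> ('n \<Rightarrow>\<^sub>0 nat) \<times> nat" where
  "lead f = (Max (Poly_Mapping.keys (lead_coeff f)), degree f)"

definition less_exp :: "('n::linorder \<Rightarrow>\<^sub>0 nat) \<times> nat \<Rightarrow> ('n \<Rightarrow>\<^sub>0 nat) \<times> nat \<Rightarrow> bool" where
  "less_exp m m' \<longleftrightarrow> snd m < snd m' \<or> snd m = snd m' \<and> fst m < fst m'"

lemma less_exp_trans: "less_exp x y \<Longrightarrow> less_exp y z \<Longrightarrow> less_exp x z"
  by (auto simp: less_exp_def)

lemma less_exp_irrefl: "\<not> less_exp x x"
  by (auto simp: less_exp_def)

lemma lead_in_supp: assumes "f \<noteq> 0" shows "lead f \<in> supp f"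
proof -
  have "Poly_Mapping.keys (lead_coeff f) \<noteq> {}" using assms by simp
  then have "Max (Poly_Mapping.keys (lead_coeff f)) \<in> Poly_Mapping.keys (lead_coeff f)" by (intro Max_in) auto
  then show ?thesis by (simp add: lead_def supp_def in_keys_iff)
qed

lemma lead_greatest: assumes "m \<in> supp f" "m \<noteq> lead f" shows "less_exp m (lead f)"
proof -
  obtain a b where [simp]: "m = (a, b)" by force
  have n: "Poly_Mapping.lookup (poly.coeff f b) a \<noteq> 0" using assms by (simp add: supp_def)
  then have "b \<le> degree f" by (metis le_degree lookup_zero)
  moreover have "a \<le> Max (Poly_Mapping.keys (lead_coeff f))" if "b = degree f"
    using n that by (intro Max_ge) (auto simp: in_keys_iff)
  ultimately show ?thesis using assms(2) by (auto simp: lead_def less_exp_def le_less)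
qed

lemma lead_eqI: assumes "m \<in> supp f" "\<And>m'. m' \<in> supp f \<Longrightarrow> m' = m \<or> less_exp m' m" shows "lead f = m"
proof -
  have "f \<noteq> 0" using assms(1) by auto
  then show ?thesis using assms lead_in_supp lead_greatest less_exp_trans less_exp_irrefl by metis
qed

text \<open>
  Splitting off the leading terms of both factors, every other product of terms has an exponent
  strictly below the sum of the two maxima, so the product of the leading terms survives.
\<close>

lemma Max_keys_mult:
  fixes p q :: "('n::linorder, 'k::field) mpoly"
  assumes "p \<noteq> 0" "q \<noteq> 0"
  shows "Max (Poly_Mapping.keys (p * q)) = Max (Poly_Mapping.keys p) + Max (Poly_Mapping.keys q)"
proof -
  let ?P = "Poly_Mapping.keys p" and ?Q = "Poly_Mapping.keys q"
  define m n where "m = Max ?P" and "n = Max ?Q"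
  have m: "m \<in> ?P" "\<And>k. k \<in> ?P \<Longrightarrow> k \<le> m" and n: "n \<in> ?Q" "\<And>k. k \<in> ?Q \<Longrightarrow> k \<le> n"
    using assms by (auto simp: m_def n_def)
  define c d where "c = Poly_Mapping.lookup p m" and "d = Poly_Mapping.lookup q n"
  define p' q' where "p' = p - Poly_Mapping.single m c" and "q' = q - Poly_Mapping.single n d"
  have p': "k < m" if "k \<in> Poly_Mapping.keys p'" for k
    using that m(2)[of k] by (auto simp: p'_def in_keys_iff lookup_minus lookup_single c_def when_def le_less split: if_splits)
  have q': "k < n" if "k \<in> Poly_Mapping.keys q'" for k
    using that n(2)[of k] by (auto simp: q'_def in_keys_iff lookup_minus lookup_single d_def when_def le_less split: if_splits)
  have eq: "p * q = Poly_Mapping.single (m + n) (c * d) + (p' * q + Poly_Mapping.single m c * q')"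
    by (simp add: p'_def q'_def algebra_simps mult_single)
  have 1: "k < m + n" if k: "k \<in> Poly_Mapping.keys (p' * q)" for k
  proof -
    obtain a b where "k = a + b" "a \<in> Poly_Mapping.keys p'" "b \<in> ?Q"
      using k keys_mult[of p' q] by blast
    then show ?thesis using p' n(2) add_less_le_mono by blast
  qed
  have 2: "k < m + n" if k: "k \<in> Poly_Mapping.keys (Poly_Mapping.single m c * q')" for k
  proof -
    obtain a b where "k = a + b" "a \<in> Poly_Mapping.keys (Poly_Mapping.single m c)" "b \<in> Poly_Mapping.keys q'"
      using k keys_mult[of "Poly_Mapping.single m c" q'] by blast
    then show ?thesis using q' by (auto split: if_splits)
  qed
  have r: "k < m + n" if "k \<in> Poly_Mapping.keys (p' * q + Poly_Mapping.single m c * q')" for k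
    using subsetD[OF keys_add that] 1 2 by (metis Un_iff)
  have "Poly_Mapping.lookup (p * q) (m + n) = c * d"
    unfolding eq lookup_add[of "Poly_Mapping.single (m + n) (c * d)"] using r[of "m + n"]
    by (auto simp: in_keys_iff)
  moreover have "c * d \<noteq> 0" using m(1) n(1) by (auto simp: c_def d_def in_keys_iff)
  ultimately have "m + n \<in> Poly_Mapping.keys (p * q)" by (simp add: in_keys_iff)
  moreover have "k \<le> m + n" if k: "k \<in> Poly_Mapping.keys (p * q)" for k
  proof -
    obtain a b where "k = a + b" "a \<in> ?P" "b \<in> ?Q" using subsetD[OF keys_mult k] by blast
    then show ?thesis using m(2) n(2) by (simp add: add_mono)
  qed
  ultimately have "Max (Poly_Mapping.keys (p * q)) = m + n" by (intro Max_eqI) auto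
  then show ?thesis by (simp add: m_def n_def)
qed

lemma lead_mult:
  fixes f g :: "('n::linorder, 'k::field) mpoly poly"
  assumes "f \<noteq> 0" "g \<noteq> 0"
  shows "lead (f * g) = lead f + lead g"
  using assms unfolding lead_def lead_coeff_mult by (simp add: Max_keys_mult degree_mult_eq)

lemma lead_1: "lead (1 :: ('n::linorder, 'k::field) mpoly poly) = 0"
  by (simp add: lead_def zero_prod_def)

lemma lead_power:
  fixes f :: "('n::linorder, 'k::field) mpoly poly"
  assumes "f \<noteq> 0"
  shows "lead (f ^ k) = (\<Sum>i<k. lead f)"
  using assms by (induction k) (auto simp: lead_1 lead_mult add.commute)

lemma lead_monz: "lead (monz a b :: ('n::linorder, 'k::field) mpoly poly) = (a, b)"
  by (rule lead_eqI) (auto simp: supp_monz)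

lemma monz_neq_0: "(monz a b :: ('n, 'k::field) mpoly poly) \<noteq> 0"
  using supp_monz[of a b] by (metis insert_not_empty supp_0)

lemma lead_cancel:
  fixes f h :: "('n::linorder, 'k::field) mpoly poly"
  assumes "f \<noteq> 0" "h \<noteq> 0" "lead f = lead h"
  obtains c where "f = const c * h \<or> less_exp (lead (f - const c * h)) (lead f)"
proof -
  let ?lc = "\<lambda>f. Poly_Mapping.lookup (poly.coeff f (snd (lead h))) (fst (lead h))"
  define c where "c = ?lc f / ?lc h"
  have h: "?lc h \<noteq> 0" using lead_in_supp[OF assms(2)] by (auto simp: supp_def)
  have lk: "Poly_Mapping.lookup (Poly_Mapping.single 0 c * p) x = c * Poly_Mapping.lookup p x" for p :: "('n, 'k) mpoly" and x
    by (simp flip: mult_map_scale_conv_mult add: map.rep_eq when_def)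
  have "?lc (f - const c * h) = 0"
  proof -
    have "?lc (f - const c * h) = ?lc f - c * ?lc h" by (simp add: lookup_minus lk)
    then show ?thesis using h by (simp add: c_def)
  qed
  then have n: "lead h \<notin> supp (f - const c * h)" by (auto simp: supp_def)
  have "supp (const c * h) \<subseteq> supp h"
    by (auto simp: supp_def lk)
  then have s: "supp (f - const c * h) \<subseteq> supp f \<union> supp h" using supp_diff by blast
  show ?thesis
  proof (cases "f - const c * h = 0")
    case True then show ?thesis using that by auto
  next
    case False
    note l = lead_in_supp[OF this]
    have "lead (f - const c * h) \<in> supp f \<union> supp h" using l s by (rule subsetD[rotated])
    moreover have "lead (f - const c * h) \<noteq> lead h" using l n by metis
    ultimately have "less_exp (lead (f - const c * h)) (lead f)"
      using lead_greatest[of "lead (f - const c * h)" f] lead_greatest[of "lead (f - const c * h)" h] assms(3)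
      by (metis Un_iff)
    then show ?thesis using that by blast
  qed
qed

section \<open>Completely integrally closed monoid rings\<close>

text \<open>
  Complete integral closedness of a monoid, written without subtraction: a difference \<open>p - q\<close> of
  elements of \<open>M\<close> is in \<open>M\<close> if some \<open>d\<close> keeps all \<open>d + k (p - q)\<close> in \<open>M\<close>.
\<close>

definition completely_closed :: "(('n \<Rightarrow>\<^sub>0 nat) \<times> nat) set \<Rightarrow> bool" where
  "completely_closed M \<longleftrightarrow> (\<forall>p\<in>M. \<forall>q\<in>M. \<forall>d\<in>M.
     (\<forall>k::nat. \<exists>m\<in>M. d + (\<Sum>i<k. p) = (\<Sum>i<k. q) + m) \<longrightarrow> (\<exists>m\<in>M. p = q + m))"

text \<open>
  If \<open>d\<close> is a common denominator of all powers of \<open>f / g\<close>, taking leading exponents puts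
  \<open>lead f - lead g\<close> in \<open>M\<close>.  Subtracting a multiple \<open>g e\<close> from \<open>f\<close> then lowers the leading exponent,
  and \<open>d\<close> still works for \<open>(f - g e) / g = f / g - e\<close> by the binomial theorem.  The descent
  ends because only finitely many elements of \<open>M\<close> lie below a given exponent.
\<close>

lemma monoid_ring_completely_closed:
  fixes f g d :: "('n::linorder, 'k::field) mpoly poly"
  assumes M: "add_submonoid M" "completely_closed M" and fin: "\<And>D. finite {m \<in> M. snd m \<le> D}"
    and g: "g \<in> monoid_ring M" "g \<noteq> 0" and d: "d \<in> monoid_ring M" "d \<noteq> 0"
  shows "f \<in> monoid_ring M \<Longrightarrow> (\<And>k. \<exists>h\<in>monoid_ring M. d * f ^ k = g ^ k * h) \<Longrightarrow> \<exists>h\<in>monoid_ring M. f = g * h"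
proof (induction "card {m \<in> M. less_exp m (lead f)}" arbitrary: f rule: less_induct)
  case less
  note E = is_subring_monoid_ring[OF M(1), where 'k='k]
  obtain h where h: "\<And>k. h k \<in> monoid_ring M" "\<And>k. d * f ^ k = g ^ k * h k" using less(3) by metis
  show ?case
  proof (cases "f = 0")
    case True then show ?thesis using is_subring_0[OF E] by auto
  next
    case False
    have leadM: "lead x \<in> M" if "x \<in> monoid_ring M" "x \<noteq> 0" for x :: "('n, 'k) mpoly poly"
      using that lead_in_supp by (auto simp: monoid_ring_def)
    have "\<exists>m\<in>M. lead d + (\<Sum>i<k. lead f) = (\<Sum>i<k. lead g) + m" for k :: nat
    proof
      have nz: "h k \<noteq> 0" using h(2)[of k] False d(2) by auto
      then show "lead (h k) \<in> M" using leadM h by blast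
      show "lead d + (\<Sum>i<k. lead f) = (\<Sum>i<k. lead g) + lead (h k)"
        using arg_cong[OF h(2)[of k], of lead] nz False d(2) g(2)
        by (simp add: lead_mult lead_power)
    qed
    then obtain m where m: "m \<in> M" "lead f = lead g + m"
      using M(2) leadM[OF less(2) False] leadM[OF g] leadM[OF d] unfolding completely_closed_def by blast
    define u :: "('n, 'k) mpoly poly" where "u = monz (fst m) (snd m)"
    have u: "u \<in> monoid_ring M" "u \<noteq> 0" "lead u = m"
      using m(1) by (auto simp: u_def monz_in_monoid_ring_iff monz_neq_0 lead_monz)
    have "lead f = lead (g * u)" "g * u \<noteq> 0" using u g m by (auto simp: lead_mult)
    then obtain c where c: "f = const c * (g * u) \<or> less_exp (lead (f - const c * (g * u))) (lead f)"
      using lead_cancel[OF False] by metis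
    define e where "e = const c * u"
    have e: "e \<in> monoid_ring M" unfolding e_def
      by (intro is_subring_mult[OF E] const_in_monoid_ring[OF M(1)] u)
    have ge: "const c * (g * u) = g * e" by (simp only: e_def mult.left_commute)
    show ?thesis
    proof (cases "f = g * e")
      case True then show ?thesis using e by blast
    next
      case False
      with c ge have less_lead: "less_exp (lead (f - g * e)) (lead f)" by simp
      have f': "f - g * e \<in> monoid_ring M"
        by (intro is_subring_diff[OF E] is_subring_mult[OF E] less g e)
      have "{m \<in> M. less_exp m (lead (f - g * e))} \<subset> {m \<in> M. less_exp m (lead f)}"
      proof
        show "{m \<in> M. less_exp m (lead (f - g * e))} \<subseteq> {m \<in> M. less_exp m (lead f)}"
          using less_lead less_exp_trans by blast
        show "{m \<in> M. less_exp m (lead (f - g * e))} \<noteq> {m \<in> M. less_exp m (lead f)}"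
        proof
          assume "{m \<in> M. less_exp m (lead (f - g * e))} = {m \<in> M. less_exp m (lead f)}"
          moreover have "lead (f - g * e) \<in> {m \<in> M. less_exp m (lead f)}"
            using less_lead leadM[OF f'] False by simp
          ultimately have "less_exp (lead (f - g * e)) (lead (f - g * e))" by blast
          then show False by (simp add: less_exp_irrefl)
        qed
      qed
      moreover have "finite {m \<in> M. less_exp m (lead f)}"
        by (rule finite_subset[OF _ fin[of "snd (lead f)"]]) (auto simp: less_exp_def)
      ultimately have card: "card {m \<in> M. less_exp m (lead (f - g * e))} < card {m \<in> M. less_exp m (lead f)}"
        by (rule psubset_card_mono[rotated])
      have "\<exists>h\<in>monoid_ring M. d * (f - g * e) ^ k = g ^ k * h" for k
      proof
        have "d * (f - g * e) ^ k = d * (f + g * (- e)) ^ k" by simp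
        also have "\<dots> = (\<Sum>i\<le>k. of_nat (k choose i) * (d * f ^ i) * (g * - e) ^ (k - i))"
          unfolding binomial_ring sum_distrib_left by (simp only: mult_ac)
        also have "\<dots> = (\<Sum>i\<le>k. g ^ k * (of_nat (k choose i) * h i * (- e) ^ (k - i)))"
        proof (intro sum.cong refl)
          fix i assume "i \<in> {..k}"
          then have "g ^ k = g ^ i * g ^ (k - i)" by (simp flip: power_add)
          then show "of_nat (k choose i) * (d * f ^ i) * (g * - e) ^ (k - i) = g ^ k * (of_nat (k choose i) * h i * (- e) ^ (k - i))"
            unfolding h(2) power_mult_distrib by (simp only: mult_ac)
        qed
        finally show "d * (f - g * e) ^ k = g ^ k * (\<Sum>i\<le>k. of_nat (k choose i) * h i * (- e) ^ (k - i))"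
          by (simp only: sum_distrib_left)
        show "(\<Sum>i\<le>k. of_nat (k choose i) * h i * (- e) ^ (k - i)) \<in> monoid_ring M"
          by (intro is_subring_sum[OF E] is_subring_mult[OF E] is_subring_of_nat[OF E] h is_subring_power[OF E] is_subring_uminus[OF E] e)
      qed
      then obtain h' where h': "h' \<in> monoid_ring M" "f - g * e = g * h'" using less(1)[OF card f'] by blast
      then have "f = g * (h' + e)" by (simp add: algebra_simps)
      then show ?thesis using is_subring_add[OF E h'(1) e] by blast
    qed
  qed
qed

section \<open>Integral elements\<close>

lemma is_subring_poly:
  assumes R: "is_subring R"
  shows "is_subring {p. \<forall>i. poly.coeff p i \<in> R}"
  unfolding is_subring_def
  by (auto simp: coeff_mult coeff_1 intro!: is_subring_sum[OF R] is_subring_closed[OF R])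

text \<open>
  Multiplication by \<open>x\<close> on the module spanned by \<open>T\<close> is given by a matrix \<open>A\<close> over \<open>R\<close>.  The vector
  of the elements of \<open>T\<close> is a nonzero vector in the kernel of \<open>x - A\<close>, so \<open>x\<close> is a root of the
  characteristic polynomial of \<open>A\<close>, which is monic with coefficients in \<open>R\<close>.
\<close>

lemma integral_over_finite_module:
  fixes R :: "'a::idom set"
  assumes R: "is_subring R" and T: "finite T" "t0 \<in> T" "t0 \<noteq> 0"
    and mult: "\<And>t. t \<in> T \<Longrightarrow> \<exists>c. (\<forall>s\<in>T. c s \<in> R) \<and> x * t = (\<Sum>s\<in>T. c s * s)"
  shows "integral_over R x"
proof -
  obtain c where c: "\<And>t s. t \<in> T \<Longrightarrow> s \<in> T \<Longrightarrow> c t s \<in> R" "\<And>t. t \<in> T \<Longrightarrow> x * t = (\<Sum>s\<in>T. c t s * s)"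
    using mult by metis
  define n where "n = card T"
  obtain e where e: "bij_betw e {0..<n} T" using ex_bij_betw_nat_finite[OF T(1)] n_def by blast
  have eT: "e i \<in> T" if "i < n" for i using e that by (auto simp: bij_betw_def)
  define A where "A = Matrix.mat n n (\<lambda>(i, j). c (e i) (e j))"
  have A: "A \<in> carrier_mat n n" by (simp add: A_def)
  \<comment> \<open>The matrix \<open>x - A\<close>.\<close>
  define B where "B = Matrix.mat n n (\<lambda>(i, j). (if i = j then x else 0) - c (e i) (e j))"
  have B: "B \<in> carrier_mat n n" by (simp add: B_def)
  define w where "w = Matrix.vec n e"
  have "B *\<^sub>v w = 0\<^sub>v n"
  proof (rule eq_vecI)
    fix i assume "i < dim_vec (0\<^sub>v n :: 'a Matrix.vec)"
    then have i: "i < n" by simp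
    have "vec_index (B *\<^sub>v w) i = (\<Sum>j\<in>{0..<n}. ((if i = j then x else 0) - c (e i) (e j)) * e j)"
      using i by (simp add: B_def w_def scalar_prod_def)
    also have "\<dots> = x * e i - (\<Sum>j\<in>{0..<n}. c (e i) (e j) * e j)"
      using i by (simp add: left_diff_distrib sum_subtractf if_distrib[of "\<lambda>y. y * _"] cong: if_cong)
    also have "(\<Sum>j\<in>{0..<n}. c (e i) (e j) * e j) = x * e i"
      unfolding c(2)[OF eT[OF i]] by (rule sum.reindex_bij_betw[OF e, where g = "\<lambda>s. c (e i) s * s"])
    finally show "vec_index (B *\<^sub>v w) i = vec_index (0\<^sub>v n) i" using i by simp
  qed (simp add: B_def)
  moreover have "w \<noteq> 0\<^sub>v n"
  proof
    assume w0: "w = 0\<^sub>v n"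
    obtain i where i: "i < n" "e i = t0" using T(2) e by (auto simp: bij_betw_def image_iff)
    have "vec_index w i = t0" using i by (simp add: w_def)
    with w0 i T(3) show False by simp
  qed
  ultimately have "Determinant.det B = 0"
    unfolding det_0_iff_vec_prod_zero[OF B] by (intro exI[of _ w]) (auto simp: w_def)
  moreover have "poly (char_poly A) x = Determinant.det B"
    unfolding char_poly_def
    by (rule poly_det_cong[OF B]) (use A in \<open>auto simp: B_def A_def char_poly_matrix_def\<close>)
  ultimately have root: "poly (char_poly A) x = 0" by simp
  have C: "char_poly_matrix A \<in> carrier_mat n n" using A by simp
  note RX = is_subring_poly[OF R]
  have entries: "char_poly_matrix A $$ (i, j) \<in> {p. \<forall>k. poly.coeff p k \<in> R}" if "i < n" "j < n" for i j
    using that eT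
    by (auto simp: char_poly_matrix_def A_def coeff_pCons split: nat.splits
         intro!: is_subring_closed[OF R] c(1))
  have sgn: "signof p \<in> {p. \<forall>k. poly.coeff p k \<in> R}" for p
    using is_subring_1[OF RX] is_subring_uminus[OF RX is_subring_1[OF RX]] by (simp add: sign_def)
  have "char_poly A \<in> {p. \<forall>k. poly.coeff p k \<in> R}"
    unfolding char_poly_def det_def'[OF C]
    by (intro is_subring_sum[OF RX] is_subring_mult[OF RX] is_subring_prod[OF RX] sgn entries)
       (auto dest: permutes_in_image)
  then show ?thesis unfolding integral_over_def
    using root degree_monic_char_poly[OF A] by auto
qed

lemma integral_over_to_fract:
  fixes x :: "'a::idom"
  assumes "integral_over R x" "0 \<in> R"
  shows "integral_over (to_fract ` R) (to_fract x)"
proof -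
  obtain p where p: "lead_coeff p = 1" "\<forall>i. poly.coeff p i \<in> R" "poly p x = 0"
    using assms(1) by (auto simp: integral_over_def)
  have "degree (fract_poly p) = degree p" using p(1) by (intro degree_map_poly) auto
  then have "lead_coeff (fract_poly p) = 1" using p(1) by (simp add: coeff_map_poly)
  moreover have "\<forall>i. poly.coeff (fract_poly p) i \<in> to_fract ` R" using p(2) by (simp add: coeff_map_poly)
  moreover have "poly (fract_poly p) (to_fract x) = to_fract (poly p x)"
    by (induction p) (simp_all add: map_poly_pCons)
  ultimately show ?thesis unfolding integral_over_def using p(3) by (intro exI[of _ "fract_poly p"]) auto
qed

text \<open>
  If \<open>x = f / g\<close> satisfies a monic equation of degree \<open>n\<close>, then \<open>d = g\<^sup>n\<close> is a common denominator of all
  powers of \<open>x\<close>: it clears the powers below the \<open>n\<close>-th, and the equation reduces the others to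
  these.
\<close>

lemma integral_closure_almost_integral:
  fixes R :: "'a::idom set"
  assumes R: "is_subring R" and x: "x \<in> integral_closure R"
  obtains f g d where "f \<in> R" "g \<in> R" "g \<noteq> 0" "d \<in> R" "d \<noteq> 0" "x = to_fract f / to_fract g"
    "\<forall>k. \<exists>h\<in>R. d * f ^ k = g ^ k * h"
proof -
  obtain f g where fg: "f \<in> R" "g \<in> R" "g \<noteq> 0" and xfg: "x = to_fract f / to_fract g"
    using x by (auto simp: integral_closure_def fraction_field_of_def Fract_conv_to_fract)
  obtain p where p: "lead_coeff p = 1" "\<And>i. poly.coeff p i \<in> to_fract ` R" "poly p x = 0"
    using x by (auto simp: integral_closure_def integral_over_def)
  define n where "n = degree p"
  have "\<forall>i. \<exists>r. r \<in> R \<and> poly.coeff p i = to_fract r" using p(2) by blast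
  from choice[OF this] obtain r where r: "\<And>i. r i \<in> R" "\<And>i. poly.coeff p i = to_fract (r i)" by blast
  have tfp: "to_fract (a ^ k) = to_fract a ^ k" for a :: 'a and k by (induction k) auto
  have "0 = (\<Sum>i<n. poly.coeff p i * x ^ i) + x ^ n"
    using p(1,3) unfolding poly_altdef n_def by (simp flip: lessThan_Suc_atMost)
  then have xn: "x ^ n = - (\<Sum>i<n. to_fract (r i) * x ^ i)" by (simp add: r(2) add_eq_0_iff2)
  have claim: "\<exists>h\<in>R. to_fract (g ^ n) * x ^ k = to_fract h" for k
  proof (induction k rule: less_induct)
    case (less k)
    show ?case
    proof (cases "k < n")
      case True
      then have "g ^ n = g ^ (n - k) * g ^ k" by (simp flip: power_add)
      then have "to_fract (g ^ n) * x ^ k = to_fract (g ^ (n - k) * f ^ k)"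
        using fg(3) by (simp add: xfg tfp power_divide)
      then show ?thesis using is_subring_mult[OF R is_subring_power[OF R fg(2)] is_subring_power[OF R fg(1)]] by blast
    next
      case False
      define j where "j = k - n"
      have k: "k = j + n" using False by (simp add: j_def)
      have "\<exists>h\<in>R. i < n \<longrightarrow> to_fract (g ^ n) * x ^ (j + i) = to_fract h" for i
        using less[of "j + i"] is_subring_0[OF R] by (cases "i < n") (auto simp: k)
      then obtain h where h: "\<And>i. h i \<in> R" "\<And>i. i < n \<Longrightarrow> to_fract (g ^ n) * x ^ (j + i) = to_fract (h i)" by metis
      have "to_fract (g ^ n) * x ^ k = - (\<Sum>i<n. to_fract (r i) * (to_fract (g ^ n) * x ^ (j + i)))"
        unfolding k power_add[of x j n] xn by (simp add: sum_distrib_left power_add mult_ac)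
      also have "\<dots> = to_fract (- (\<Sum>i<n. r i * h i))" by (simp add: h(2) del: tfp)
      finally show ?thesis
        using is_subring_uminus[OF R is_subring_sum[OF R, of "{..<n}" "\<lambda>i. r i * h i"]] r(1) h(1) is_subring_mult[OF R]
        by blast
    qed
  qed
  have "\<exists>h\<in>R. g ^ n * f ^ k = g ^ k * h" for k
  proof -
    obtain h where h: "h \<in> R" "to_fract (g ^ n) * x ^ k = to_fract h" using claim by blast
    then have "to_fract (g ^ n * f ^ k) = to_fract (g ^ k * h)"
      using fg(3) by (simp add: xfg tfp power_divide field_simps)
    then show ?thesis using h(1) unfolding to_fract_eq_iff by blast
  qed
  then have almost: "\<forall>k. \<exists>h\<in>R. g ^ n * f ^ k = g ^ k * h" ..
  show ?thesis
    by (rule that[OF fg is_subring_power[OF R fg(2)] _ xfg almost]) (simp add: fg(3))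
qed

section \<open>Exponents as real vectors\<close>

definition nat_exp :: "('n::finite \<Rightarrow>\<^sub>0 nat) \<times> nat \<Rightarrow> (real ^ 'n) \<times> real" where
  "nat_exp m = (vec_of (fst m), real (snd m))"

lemma vec_of_0 [simp]: "vec_of 0 = 0"
  by (simp add: vec_of_def Finite_Cartesian_Product.vec_eq_iff)

lemma vec_of_add: "vec_of (a + b) = vec_of a + vec_of b"
  by (simp add: vec_of_def Finite_Cartesian_Product.vec_eq_iff lookup_add)

lemma vec_of_nth [simp]: "vec_of a $ i = real (Poly_Mapping.lookup a i)"
  by (simp add: vec_of_def)

lemma vec_of_eq_iff: "vec_of a = vec_of b \<longleftrightarrow> a = b"
  by (simp add: Finite_Cartesian_Product.vec_eq_iff poly_mapping_eq_iff fun_eq_iff)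

lemma vec_of_single: "vec_of (Poly_Mapping.single i 1) = axis i 1"
  by (simp add: Finite_Cartesian_Product.vec_eq_iff axis_def lookup_single when_def)

lemma nat_exp_add: "nat_exp (m + m') = nat_exp m + nat_exp m'"
  by (simp add: nat_exp_def vec_of_add)

lemma nat_exp_0 [simp]: "nat_exp 0 = 0"
  by (simp add: nat_exp_def zero_prod_def)

lemma nat_exp_sum: "nat_exp (sum f A) = (\<Sum>x\<in>A. nat_exp (f x))"
  by (induction A rule: infinite_finite_induct) (auto simp: nat_exp_add)

lemma nat_exp_multiple: "nat_exp (\<Sum>i<(k::nat). m) = real k *\<^sub>R nat_exp m"
  by (simp add: nat_exp_sum sum_constant_scaleR)

lemma nat_exp_eq_iff: "nat_exp m = nat_exp m' \<longleftrightarrow> m = m'"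
  by (auto simp: nat_exp_def vec_of_eq_iff prod_eq_iff)

lemma add_submonoid_sum: "add_submonoid M \<Longrightarrow> (\<And>x. x \<in> A \<Longrightarrow> f x \<in> M) \<Longrightarrow> sum f A \<in> M"
  by (induction A rule: infinite_finite_induct) (auto simp: add_submonoid_def)

section \<open>Lattice points of the cone over a polytope\<close>

definition ehrhart_exponents :: "(real ^ 'n) set \<Rightarrow> (('n::finite \<Rightarrow>\<^sub>0 nat) \<times> nat) set" where
  "ehrhart_exponents P = {(a, b). vec_of a \<in> (\<lambda>x. real b *\<^sub>R x) ` P}"

definition height_cone :: "'a::real_vector set \<Rightarrow> ('a \<times> real) set" where
  "height_cone P = conic hull (P \<times> {1})"

lemma height_cone_iff: "(x, t) \<in> height_cone P \<longleftrightarrow> 0 \<le> t \<and> x \<in> (\<lambda>y. t *\<^sub>R y) ` P"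
  by (auto simp: height_cone_def conic_hull_explicit)

lemma ehrhart_exponents_iff: "m \<in> ehrhart_exponents P \<longleftrightarrow> nat_exp m \<in> height_cone P"
  by (auto simp: ehrhart_exponents_def nat_exp_def height_cone_iff split: prod.splits)

lemma height_cone_add:
  assumes "convex P" "x \<in> height_cone P" "y \<in> height_cone P"
  shows "x + y \<in> height_cone P"
proof -
  have "convex (height_cone P)" unfolding height_cone_def
    by (intro convex_conic_hull convex_Times assms) auto
  then have "convex_cone (height_cone P)"
    using assms(2) unfolding convex_cone_def height_cone_def by (auto simp: conic_conic_hull)
  then show ?thesis using convex_cone_add assms by blast
qed

lemma height_cone_scale: "x \<in> height_cone P \<Longrightarrow> 0 \<le> c \<Longrightarrow> c *\<^sub>R x \<in> height_cone P"
  unfolding height_cone_def by (rule conic_mul[OF conic_conic_hull])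

lemma height_cone_0: "P \<noteq> {} \<Longrightarrow> 0 \<in> height_cone P"
  unfolding height_cone_def by simp

lemma height_cone_sum:
  assumes "convex P" "P \<noteq> {}" "\<And>x. x \<in> A \<Longrightarrow> f x \<in> height_cone P"
  shows "sum f A \<in> height_cone P"
  using assms(3)
  by (induction A rule: infinite_finite_induct) (auto simp: height_cone_0[OF assms(2)] height_cone_add[OF assms(1)])

lemma closed_height_cone:
  fixes P :: "'a::euclidean_space set"
  assumes "compact P" shows "closed (height_cone P)"
  unfolding height_cone_def
  by (rule closed_conic_hull) (use assms in \<open>auto intro!: compact_Times simp: zero_prod_def\<close>)

lemma submonoid_ehrhart_exponents:
  assumes "convex P" "P \<noteq> {}" shows "add_submonoid (ehrhart_exponents P)"
  unfolding add_submonoid_def Ball_def ehrhart_exponents_iff nat_exp_add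
  using height_cone_0[OF assms(2)] height_cone_add[OF assms(1)] by simp

lemma finite_bounded_exponents: "finite {a :: 'n::finite \<Rightarrow>\<^sub>0 nat. \<forall>i. Poly_Mapping.lookup a i \<le> N}"
proof (rule finite_imageD)
  show "finite (Poly_Mapping.lookup ` {a :: 'n \<Rightarrow>\<^sub>0 nat. \<forall>i. Poly_Mapping.lookup a i \<le> N})"
    by (rule finite_subset[of _ "PiE UNIV (\<lambda>_. {..N})"]) (auto intro: finite_PiE)
  show "inj_on Poly_Mapping.lookup {a :: 'n \<Rightarrow>\<^sub>0 nat. \<forall>i. Poly_Mapping.lookup a i \<le> N}"
    by (auto intro!: inj_onI poly_mapping_eqI)
qed

lemma finite_ehrhart_exponents_level:
  fixes P :: "(real ^ 'n::finite) set"
  assumes "bounded P" shows "finite {m \<in> ehrhart_exponents P. snd m \<le> D}"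
proof -
  obtain B where B: "\<And>x. x \<in> P \<Longrightarrow> norm x \<le> B" using assms by (auto simp: bounded_iff)
  define N where "N = nat \<lceil>real D * B\<rceil>"
  have "Poly_Mapping.lookup a i \<le> N" if m: "(a, b) \<in> ehrhart_exponents P" "b \<le> D" for a b i
  proof -
    obtain x where x: "x \<in> P" "vec_of a = real b *\<^sub>R x" using m(1) by (auto simp: ehrhart_exponents_def)
    have "real (Poly_Mapping.lookup a i) = real b * x $ i" using arg_cong[OF x(2), of "\<lambda>y. y $ i"] by simp
    also have "\<dots> \<le> real b * norm x" by (intro mult_left_mono) (auto intro: order_trans[OF abs_ge_self component_le_norm_cart])
    also have "\<dots> \<le> real D * B" using m(2) B[OF x(1)] by (intro mult_mono) auto
    finally show ?thesis unfolding N_def by linarith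
  qed
  then have "{m \<in> ehrhart_exponents P. snd m \<le> D} \<subseteq> {a. \<forall>i. Poly_Mapping.lookup a i \<le> N} \<times> {..D}" by auto
  then show ?thesis by (rule finite_subset) (intro finite_SigmaI finite_bounded_exponents, auto)
qed

text \<open>
  Points of the cone are nonnegative, so a difference of exponents that lies in the cone is again
  a vector of natural numbers.
\<close>

lemma ehrhart_exponents_diff:
  fixes P :: "(real ^ 'n::finite) set"
  assumes nonneg: "\<And>x i. x \<in> P \<Longrightarrow> 0 \<le> x $ i"
    and C: "nat_exp p - nat_exp q \<in> height_cone P"
  shows "\<exists>m\<in>ehrhart_exponents P. p = q + m"
proof
  let ?m = "(fst p - fst q, snd p - snd q)"
  obtain y where y: "real (snd q) \<le> real (snd p)" "y \<in> P"
      "vec_of (fst p) - vec_of (fst q) = (real (snd p) - real (snd q)) *\<^sub>R y"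
    using C unfolding nat_exp_def by (auto simp: height_cone_iff)
  have "Poly_Mapping.lookup (fst q) i \<le> Poly_Mapping.lookup (fst p) i" for i
  proof -
    have "0 \<le> (real (snd p) - real (snd q)) * y $ i" using y(1) nonneg[OF y(2)] by simp
    also have "\<dots> = real (Poly_Mapping.lookup (fst p) i) - real (Poly_Mapping.lookup (fst q) i)"
      using arg_cong[OF y(3), of "\<lambda>y. y $ i"] by simp
    finally show ?thesis by simp
  qed
  then have "fst p = fst q + (fst p - fst q)" by (intro poly_mapping_eqI) (simp add: lookup_add lookup_minus)
  then show p: "p = q + ?m" using y(1) by (simp add: prod_eq_iff)
  have "nat_exp p = nat_exp q + nat_exp ?m" by (subst p) (rule nat_exp_add)
  then show "?m \<in> ehrhart_exponents P" using C unfolding ehrhart_exponents_iff by simp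
qed

text \<open>
  From \<open>d + k (p - q)\<close> in the cone for all \<open>k\<close> it follows that \<open>p - q + d / k\<close> is in the cone, which is
  closed; let \<open>k\<close> tend to infinity.
\<close>

lemma completely_closed_ehrhart_exponents:
  fixes P :: "(real ^ 'n::finite) set"
  assumes P: "compact P" and nonneg: "\<And>x i. x \<in> P \<Longrightarrow> 0 \<le> x $ i"
  shows "completely_closed (ehrhart_exponents P)"
  unfolding completely_closed_def
proof (intro ballI impI)
  fix p q d :: "('n \<Rightarrow>\<^sub>0 nat) \<times> nat"
  assume *: "\<forall>k::nat. \<exists>m\<in>ehrhart_exponents P. d + (\<Sum>i<k. p) = (\<Sum>i<k. q) + m"
  define s where "s j = nat_exp p - nat_exp q + inverse (real (Suc j)) *\<^sub>R nat_exp d" for j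
  have "s j \<in> height_cone P" for j
  proof -
    obtain m where m: "m \<in> ehrhart_exponents P" "d + (\<Sum>i<Suc j. p) = (\<Sum>i<Suc j. q) + m" using * by blast
    have "nat_exp d + real (Suc j) *\<^sub>R nat_exp p = real (Suc j) *\<^sub>R nat_exp q + nat_exp m"
      using arg_cong[OF m(2), of nat_exp] by (simp only: nat_exp_add nat_exp_multiple)
    then have "nat_exp m = nat_exp d + real (Suc j) *\<^sub>R (nat_exp p - nat_exp q)"
      by (simp add: algebra_simps)
    then have "s j = inverse (real (Suc j)) *\<^sub>R nat_exp m"
      by (simp add: s_def scaleR_add_right del: of_nat_Suc)
    then show ?thesis using m(1) height_cone_scale[of "nat_exp m" P "inverse (real (Suc j))"]
      by (simp add: ehrhart_exponents_iff)
  qed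
  moreover have "s \<longlonglongrightarrow> nat_exp p - nat_exp q + 0 *\<^sub>R nat_exp d"
    unfolding s_def by (intro tendsto_intros LIMSEQ_inverse_real_of_nat)
  ultimately have "nat_exp p - nat_exp q + 0 *\<^sub>R nat_exp d \<in> height_cone P"
    using closed_height_cone[OF P] unfolding closed_sequential_limits by blast
  then show "\<exists>m\<in>ehrhart_exponents P. p = q + m" by (intro ehrhart_exponents_diff nonneg) auto
qed

section \<open>The monoid generated at height one\<close>

definition height_one_monoid :: "('n::finite \<Rightarrow>\<^sub>0 nat) set \<Rightarrow> (('n \<Rightarrow>\<^sub>0 nat) \<times> nat) set" where
  "height_one_monoid A = {m. nat_exp m \<in> nat_combinations ((\<lambda>a. (vec_of a, 1)) ` A)}"

text \<open>
  An element of a set of vectors carries a single coefficient, so reindexing the combination by \<open>A\<close>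
  needs that exponents embed injectively into the real vectors.
\<close>

lemma height_one_monoid_eq:
  assumes A: "finite A"
  shows "height_one_monoid A = {\<Sum>a\<in>A. \<Sum>i<(c a::nat). (a, 1) | c. True}"
proof -
  let ?g = "\<lambda>a. (vec_of a, 1 :: real)"
  have inj: "inj_on ?g A" by (auto intro!: inj_onI simp: vec_of_eq_iff)
  have eval: "nat_exp (\<Sum>a\<in>A. \<Sum>i<(c a::nat). (a, 1)) = (\<Sum>a\<in>A. real (c a) *\<^sub>R ?g a)" for c
    by (simp add: nat_exp_sum[of _ A] nat_exp_multiple) (simp add: nat_exp_def)
  show ?thesis
  proof safe
    fix a b assume "(a, b) \<in> height_one_monoid A"
    then obtain F c where F: "F \<subseteq> ?g ` A" "nat_exp (a, b) = (\<Sum>x\<in>F. real (c x) *\<^sub>R x)"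
      by (auto simp: height_one_monoid_def nat_combinations_def)
    define c' where "c' y = (if ?g y \<in> F then c (?g y) else 0)" for y
    have "(\<Sum>x\<in>F. real (c x) *\<^sub>R x) = (\<Sum>x\<in>?g ` A. real (if x \<in> F then c x else 0) *\<^sub>R x)"
      using A F(1) by (intro sum.mono_neutral_cong_left) auto
    also have "\<dots> = (\<Sum>y\<in>A. real (c' y) *\<^sub>R ?g y)"
      unfolding sum.reindex[OF inj] by (simp add: c'_def o_def)
    finally have "nat_exp (a, b) = nat_exp (\<Sum>a\<in>A. \<Sum>i<(c' a::nat). (a, 1))" by (simp only: F(2) eval)
    then show "\<exists>c. (a, b) = (\<Sum>a\<in>A. \<Sum>i<(c a::nat). (a, 1)) \<and> True" by (auto simp: nat_exp_eq_iff)
  next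
    fix a b and c :: "_ \<Rightarrow> nat" assume ab: "(a, b) = (\<Sum>a\<in>A. \<Sum>i<c a. (a, 1::nat))"
    have "nat_exp (a, b) = (\<Sum>x\<in>?g ` A. real ((c \<circ> the_inv_into A ?g) x) *\<^sub>R x)"
      unfolding ab eval sum.reindex[OF inj] by (intro sum.cong) (auto simp: the_inv_into_f_f[OF inj])
    then show "(a, b) \<in> height_one_monoid A"
      using A unfolding height_one_monoid_def nat_combinations_def by blast
  qed
qed

lemma height_one_monoidI:
  "finite A \<Longrightarrow> (\<Sum>a\<in>A. \<Sum>i<(c a::nat). (a, 1)) \<in> height_one_monoid A"
  unfolding height_one_monoid_eq by (rule CollectI, rule exI[of _ c]) simp

lemma height_one_monoid_least:
  assumes "finite A" "add_submonoid N" "\<And>a. a \<in> A \<Longrightarrow> (a, 1) \<in> N"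
  shows "height_one_monoid A \<subseteq> N"
proof
  fix m assume "m \<in> height_one_monoid A"
  then obtain c :: "_ \<Rightarrow> nat" where "m = (\<Sum>a\<in>A. \<Sum>i<c a. (a, 1))"
    unfolding height_one_monoid_eq[OF assms(1)] by blast
  then show "m \<in> N" by (simp only:) (intro add_submonoid_sum[OF assms(2)] assms(3))
qed

lemma submonoid_height_one_monoid:
  assumes A: "finite A" shows "add_submonoid (height_one_monoid A)"
  unfolding add_submonoid_def
proof (intro conjI ballI)
  show "0 \<in> height_one_monoid A" unfolding height_one_monoid_eq[OF A] by (auto intro!: exI[of _ "\<lambda>_. 0"])
next
  fix x y assume "x \<in> height_one_monoid A" "y \<in> height_one_monoid A"
  then obtain c d :: "_ \<Rightarrow> nat" where "x = (\<Sum>a\<in>A. \<Sum>i<c a. (a, 1))" "y = (\<Sum>a\<in>A. \<Sum>i<d a. (a, 1))"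
    unfolding height_one_monoid_eq[OF A] by blast
  then have "nat_exp (x + y) = nat_exp (\<Sum>a\<in>A. \<Sum>i<c a + d a. (a, 1))"
    by (simp only: nat_exp_add nat_exp_sum[of _ A] nat_exp_multiple of_nat_add scaleR_add_left sum.distrib)
  then have "x + y = (\<Sum>a\<in>A. \<Sum>i<c a + d a. (a, 1))" unfolding nat_exp_eq_iff .
  then show "x + y \<in> height_one_monoid A" by (rule ssubst) (rule height_one_monoidI[OF A])
qed

lemma generator_in_height_one_monoid:
  assumes A: "finite A" and a: "a \<in> A" shows "(a, 1) \<in> height_one_monoid A"
proof -
  have "(a, 1) = (\<Sum>x\<in>A. \<Sum>i<(if x = a then 1 else 0 :: nat). (x, 1))"
    by (subst sum.remove[OF A a]) (auto intro!: sum.neutral simp: plus_prod_def)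
  then show ?thesis by (rule ssubst) (rule height_one_monoidI[OF A])
qed

lemma height_one_monoid_subset_ehrhart:
  assumes A: "finite A" "A \<noteq> {}"
  shows "height_one_monoid A \<subseteq> ehrhart_exponents (convex hull (vec_of ` A))"
proof (rule height_one_monoid_least)
  show "add_submonoid (ehrhart_exponents (convex hull (vec_of ` A)))"
    by (rule submonoid_ehrhart_exponents) (use A in auto)
  show "(a, 1) \<in> ehrhart_exponents (convex hull (vec_of ` A))" if "a \<in> A" for a
    using that by (auto simp: ehrhart_exponents_def intro: hull_inc)
qed (rule A)

lemma height_cone_convex_hull_coeffs:
  assumes A: "finite A" and m: "m \<in> ehrhart_exponents (convex hull (vec_of ` A))"
  obtains l where "\<forall>a\<in>A. 0 \<le> l a" "nat_exp m = (\<Sum>a\<in>A. l a *\<^sub>R nat_exp (a, 1))"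
proof -
  obtain x where x: "x \<in> convex hull (vec_of ` A)" "vec_of (fst m) = real (snd m) *\<^sub>R x"
    using m by (auto simp: ehrhart_exponents_def)
  have inj: "inj_on vec_of A" by (auto intro!: inj_onI simp: vec_of_eq_iff)
  obtain u where u: "\<And>a. a \<in> A \<Longrightarrow> 0 \<le> u (vec_of a)" "sum u (vec_of ` A) = 1" "(\<Sum>v\<in>vec_of ` A. u v *\<^sub>R v) = x"
    using x(1) A by (auto simp: convex_hull_finite)
  define l where "l a = real (snd m) * u (vec_of a)" for a
  have "(\<Sum>a\<in>A. l a *\<^sub>R nat_exp (a, 1)) = (\<Sum>a\<in>A. l a *\<^sub>R vec_of a, \<Sum>a\<in>A. l a)"
    by (simp add: nat_exp_def prod_eq_iff fst_sum snd_sum)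
  also have "(\<Sum>a\<in>A. l a *\<^sub>R vec_of a) = vec_of (fst m)"
    unfolding x(2) u(3)[symmetric] sum.reindex[OF inj] by (simp add: l_def scaleR_sum_right)
  also have "(\<Sum>a\<in>A. l a) = real (snd m)"
    using u(2) unfolding sum.reindex[OF inj] by (simp add: l_def flip: sum_distrib_left)
  finally show ?thesis using that[of l] u(1) by (simp add: nat_exp_def l_def)
qed

lemma nonneg_convex_hull_vec_of:
  fixes A :: "('n::finite \<Rightarrow>\<^sub>0 nat) set" and x :: "real ^ 'n"
  assumes "x \<in> convex hull (vec_of ` A)" shows "0 \<le> x $ i"
proof -
  have "convex {x :: real ^ 'n. 0 \<le> x $ i}" by (auto simp: convex_def)
  then have "convex hull (vec_of ` A) \<subseteq> {x. 0 \<le> x $ i}" by (rule hull_minimal[rotated]) auto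
  then show ?thesis using assms by auto
qed

text \<open>
  Round down the coefficients of \<open>m\<close> in terms of the generators.  The fractional parts are less than
  \<open>1\<close>, so the remainder has height at most \<open>card A\<close>; it is a difference of exponents
  that lies in the cone, hence itself an exponent.
\<close>

lemma ehrhart_exponents_decompose:
  assumes A: "finite A" and m: "m \<in> ehrhart_exponents (convex hull (vec_of ` A))"
  obtains t n where "m = n + t" "n \<in> height_one_monoid A"
    "t \<in> ehrhart_exponents (convex hull (vec_of ` A))" "snd t \<le> card A"
proof -
  let ?P = "convex hull (vec_of ` A)"
  obtain l where l: "\<forall>a\<in>A. 0 \<le> l a" "nat_exp m = (\<Sum>a\<in>A. l a *\<^sub>R nat_exp (a, 1))"
    by (rule height_cone_convex_hull_coeffs[OF A m])
  have ne: "?P \<noteq> {}" using m by (auto simp: ehrhart_exponents_def)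
  define n where "n = (\<Sum>a\<in>A. \<Sum>i<nat \<lfloor>l a\<rfloor>. (a, 1::nat))"
  have n: "n \<in> height_one_monoid A" unfolding n_def by (rule height_one_monoidI[OF A])
  have diff: "nat_exp m - nat_exp n = (\<Sum>a\<in>A. frac (l a) *\<^sub>R nat_exp (a, 1))"
    unfolding l(2) n_def nat_exp_sum[of _ A] nat_exp_multiple sum_subtractf[symmetric] scaleR_diff_left[symmetric]
    by (intro sum.cong refl) (auto simp: frac_def l(1))
  have "nat_exp m - nat_exp n \<in> height_cone ?P" unfolding diff
  proof (intro height_cone_sum height_cone_scale)
    show "nat_exp (a, 1) \<in> height_cone ?P" if "a \<in> A" for a
      using that by (auto simp: nat_exp_def height_cone_iff hull_inc)
  qed (use ne in auto)
  then have "\<exists>t\<in>ehrhart_exponents ?P. m = n + t"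
    by (rule ehrhart_exponents_diff[rotated]) (rule nonneg_convex_hull_vec_of)
  then obtain t where t: "t \<in> ehrhart_exponents ?P" "m = n + t" by blast
  have "nat_exp t = (\<Sum>a\<in>A. frac (l a) *\<^sub>R nat_exp (a, 1))" using diff t(2) by (simp add: nat_exp_add)
  then have "real (snd t) = (\<Sum>a\<in>A. frac (l a))"
    by (simp add: nat_exp_def prod_eq_iff snd_sum)
  also have "\<dots> \<le> (\<Sum>a\<in>A. 1)" by (intro sum_mono) (simp add: less_imp_le frac_lt_1)
  finally have "snd t \<le> card A" by simp
  then show ?thesis using that n t by blast
qed

section \<open>Integral closure of the monoid ring\<close>

text \<open>
  The monomials of height at most \<open>card A\<close> span the ring of the cone as a module over the ring of the
  generated monoid, and multiplication by \<open>f\<close> preserves this module.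
\<close>

lemma integral_over_height_one_monoid_ring:
  fixes f :: "('n::{finite,linorder}, 'k::field) mpoly poly"
  assumes A: "finite A" "A \<noteq> {}" and f: "f \<in> monoid_ring (ehrhart_exponents (convex hull (vec_of ` A)))"
  shows "integral_over (monoid_ring (height_one_monoid A)) f"
proof -
  let ?M = "ehrhart_exponents (convex hull (vec_of ` A))"
  let ?R = "monoid_ring (height_one_monoid A) :: ('n, 'k) mpoly poly set"
  define T :: "('n, 'k) mpoly poly set" where "T = (\<lambda>m. monz (fst m) (snd m)) ` {m \<in> ?M. snd m \<le> card A}"
  note R = is_subring_monoid_ring[OF submonoid_height_one_monoid[OF A(1)], where 'k='k]
  have subM: "add_submonoid ?M" by (rule submonoid_ehrhart_exponents) (use A in auto)
  note E = is_subring_monoid_ring[OF subM, where 'k='k]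
  have finT: "finite T" unfolding T_def
    by (intro finite_imageI finite_ehrhart_exponents_level compact_imp_bounded finite_imp_compact_convex_hull) (use A in auto)
  \<comment> \<open>The \<open>R\<close>-module spanned by \<open>T\<close>.\<close>
  define X where "X = {h. \<exists>c. (\<forall>s\<in>T. c s \<in> ?R) \<and> h = (\<Sum>s\<in>T. c s * s)}"
  have X0: "0 \<in> X" unfolding X_def using is_subring_0[OF R] by (auto intro!: exI[of _ "\<lambda>_. 0"])
  have X_add: "g + h \<in> X" if gh: "g \<in> X" "h \<in> X" for g h
  proof -
    obtain c d where cd: "\<forall>s\<in>T. c s \<in> ?R" "g = (\<Sum>s\<in>T. c s * s)" "\<forall>s\<in>T. d s \<in> ?R" "h = (\<Sum>s\<in>T. d s * s)"
      using gh unfolding X_def by blast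
    show ?thesis unfolding X_def mem_Collect_eq
      by (intro exI[of _ "\<lambda>s. c s + d s"]) (use cd is_subring_add[OF R] in \<open>auto simp: distrib_right sum.distrib\<close>)
  qed
  have X_gen: "r * s \<in> X" if rs: "r \<in> ?R" "s \<in> T" for r s
  proof -
    have "(\<Sum>s'\<in>T. (if s' = s then r else 0) * s') = (\<Sum>s'\<in>T. if s' = s then r * s' else 0)"
      by (intro sum.cong) auto
    also have "\<dots> = r * s" using rs finT by simp
    finally show ?thesis unfolding X_def mem_Collect_eq
      by (intro exI[of _ "\<lambda>s'. if s' = s then r else 0"]) (use rs is_subring_0[OF R] in auto)
  qed
  have X_sum: "sum h S \<in> X" if "\<And>i. i \<in> S \<Longrightarrow> h i \<in> X" for h :: "('n \<Rightarrow>\<^sub>0 nat) \<times> nat \<Rightarrow> _" and S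
    using that by (induction S rule: infinite_finite_induct) (auto simp: X0 X_add)
  have EX: "h \<in> X" if h: "h \<in> monoid_ring ?M" for h
  proof -
    have "const c * monz (fst m) (snd m) \<in> X" if m: "m \<in> supp h" for c m
    proof -
      have "m \<in> ?M" using m h by (auto simp: monoid_ring_def)
      from ehrhart_exponents_decompose[OF A(1) this] obtain t n where tn: "m = n + t"
        "n \<in> height_one_monoid A" "t \<in> ?M" "snd t \<le> card A" by metis
      have "const c * monz (fst m) (snd m) = (const c * monz (fst n) (snd n)) * monz (fst t) (snd t)"
        by (simp add: tn(1) monz_def Defs.mon_def mult_monom mult_single smult_monom)
      moreover have "const c * monz (fst n) (snd n) \<in> ?R"
        by (intro is_subring_mult[OF R] const_in_monoid_ring submonoid_height_one_monoid A)
           (use tn(2) in \<open>simp add: monz_in_monoid_ring_iff\<close>)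
      moreover have "monz (fst t) (snd t) \<in> T" using tn by (auto simp: T_def)
      ultimately show ?thesis using X_gen by metis
    qed
    then have "(\<Sum>(a, b)\<in>supp h. const (Poly_Mapping.lookup (poly.coeff h b) a) * monz a b) \<in> X"
      by (intro X_sum) (simp only: split_beta')
    then show ?thesis using supp_monz_expansion[of h] by simp
  qed
  have T_E: "s \<in> monoid_ring ?M" if "s \<in> T" for s using that by (auto simp: T_def monz_in_monoid_ring_iff)
  show ?thesis
  proof (rule integral_over_finite_module[OF R finT])
    show "monz 0 0 \<in> T" unfolding T_def using subM
      by (intro image_eqI[of _ _ 0]) (auto simp: add_submonoid_def)
    show "(monz 0 0 :: ('n, 'k) mpoly poly) \<noteq> 0" by (rule monz_neq_0)
    show "\<exists>c. (\<forall>s\<in>T. c s \<in> ?R) \<and> f * t = (\<Sum>s\<in>T. c s * s)" if "t \<in> T" for t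
      using EX[OF is_subring_mult[OF E f T_E[OF that]]] unfolding X_def by blast
  qed
qed

lemma zero_level_in_height_one_monoid:
  assumes A: "finite A" "(0 :: 'n::finite \<Rightarrow>\<^sub>0 nat) \<in> A"
  shows "(0, b) \<in> height_one_monoid A"
proof -
  have "(0 :: 'n \<Rightarrow>\<^sub>0 nat, b) = (\<Sum>i<b. (0, 1))" by (simp add: prod_eq_iff fst_sum snd_sum)
  then show ?thesis
    by (rule ssubst)
       (intro add_submonoid_sum[OF submonoid_height_one_monoid[OF A(1)]] generator_in_height_one_monoid[OF A])
qed

text \<open>
  An exponent \<open>a\<close> is a sum of \<open>total_degree a\<close> units.
\<close>

lemma total_degree_level_in_height_one_monoid:
  fixes a :: "'n::finite \<Rightarrow>\<^sub>0 nat"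
  assumes A: "finite A" "\<And>i. Poly_Mapping.single i 1 \<in> A"
  shows "(a, total_degree a) \<in> height_one_monoid A"
proof -
  have "(a, total_degree a) = (\<Sum>i\<in>UNIV. \<Sum>k<Poly_Mapping.lookup a i. (Poly_Mapping.single i 1, 1))"
  proof (intro prod_eqI poly_mapping_eqI)
    fix j
    have "Poly_Mapping.lookup (fst (\<Sum>i\<in>UNIV. \<Sum>k<Poly_Mapping.lookup a i. (Poly_Mapping.single i (1::nat), 1::nat))) j
       = (\<Sum>i\<in>UNIV. if i = j then Poly_Mapping.lookup a i else 0)"
      unfolding fst_sum lookup_sum by (intro sum.cong) (auto simp: lookup_single when_def)
    then show "Poly_Mapping.lookup (fst (a, total_degree a)) j = Poly_Mapping.lookup (fst (\<Sum>i\<in>UNIV. \<Sum>k<Poly_Mapping.lookup a i. (Poly_Mapping.single i (1::nat), 1::nat))) j"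
      by simp
  qed (simp add: snd_sum total_degree_def)
  then show ?thesis
    by (rule ssubst)
       (intro add_submonoid_sum[OF submonoid_height_one_monoid[OF A(1)]] generator_in_height_one_monoid A)
qed

text \<open>
  Multiplying by a high power of \<open>z\<close>, which itself belongs to the ring, raises every exponent of \<open>f\<close>
  above its total degree.
\<close>

lemma to_fract_in_fraction_field:
  fixes f :: "('n::{finite,linorder}, 'k::field) mpoly poly"
  assumes A: "finite A" "0 \<in> A" "\<And>i. Poly_Mapping.single i 1 \<in> A"
  shows "to_fract f \<in> fraction_field_of (monoid_ring (height_one_monoid A))"
proof -
  let ?M = "height_one_monoid A"
  note M = submonoid_height_one_monoid[OF A(1)]
  define N where "N = (\<Sum>m\<in>supp f. total_degree (fst m))"
  have z: "(0, b) \<in> ?M" for b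
    by (rule zero_level_in_height_one_monoid) (use A in auto)
  have deg: "(a, total_degree a) \<in> ?M" for a
    by (rule total_degree_level_in_height_one_monoid) (use A in auto)
  have "f * monz 0 N \<in> monoid_ring ?M"
  proof -
    have "m \<in> ?M" if m: "m \<in> supp (f * monz 0 N)" for m
    proof -
      obtain a b where ab: "(a, b) \<in> supp f" "m = (a, b + N)"
        using subsetD[OF supp_mult m] by (auto simp: supp_monz)
      have "total_degree a \<le> N" unfolding N_def
        using member_le_sum[OF ab(1), of "\<lambda>m. total_degree (fst m)"] finite_supp by auto
      then have "m = (a, total_degree a) + (0, b + N - total_degree a)" by (simp add: ab(2))
      then show ?thesis using M deg z unfolding add_submonoid_def by metis
    qed
    then show ?thesis by (auto simp: monoid_ring_def)
  qed
  moreover have "monz 0 N \<in> (monoid_ring ?M :: ('n, 'k) mpoly poly set)" using z by (simp add: monz_in_monoid_ring_iff)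
  moreover have "to_fract f = Fract (f * monz 0 N) (monz 0 N)"
    by (simp add: Fract_conv_to_fract monz_neq_0)
  ultimately show ?thesis unfolding fraction_field_of_def using monz_neq_0 by blast
qed

text \<open>
  Integral fractions over the smaller ring have a common denominator for all powers, so complete
  integral closedness of the larger ring catches them; its elements are integral and are fractions
  over the smaller ring.
\<close>

theorem integral_closure_height_one_monoid_ring:
  fixes A :: "('n::{finite,linorder} \<Rightarrow>\<^sub>0 nat) set"
  assumes A: "finite A" "0 \<in> A" "\<And>i. Poly_Mapping.single i 1 \<in> A"
  shows "integral_closure (monoid_ring (height_one_monoid A) :: ('n, 'k::field) mpoly poly set)
    = to_fract ` (monoid_ring (ehrhart_exponents (convex hull (vec_of ` A))))"
proof (intro equalityI subsetI)
  let ?P = "convex hull (vec_of ` A)"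
  let ?R = "monoid_ring (height_one_monoid A) :: ('n, 'k) mpoly poly set"
  let ?E = "monoid_ring (ehrhart_exponents ?P) :: ('n, 'k) mpoly poly set"
  note R = is_subring_monoid_ring[OF submonoid_height_one_monoid[OF A(1)], where 'k='k]
  have ne: "A \<noteq> {}" using A(2) by auto
  {
    fix x assume x: "x \<in> integral_closure ?R"
    obtain f g d where fgd: "f \<in> ?R" "g \<in> ?R" "g \<noteq> 0" "d \<in> ?R" "d \<noteq> 0" "x = to_fract f / to_fract g"
      "\<forall>k. \<exists>h\<in>?R. d * f ^ k = g ^ k * h"
      by (rule integral_closure_almost_integral[OF R x])
    have sub: "?R \<subseteq> ?E" using height_one_monoid_subset_ehrhart[OF A(1) ne] by (auto simp: monoid_ring_def)
    have cpt: "compact ?P" by (intro finite_imp_compact_convex_hull finite_imageI A)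
    have "\<exists>h\<in>?E. f = g * h"
    proof (rule monoid_ring_completely_closed)
      show "add_submonoid (ehrhart_exponents ?P)" by (rule submonoid_ehrhart_exponents) (use ne in auto)
      show "completely_closed (ehrhart_exponents ?P)"
        by (rule completely_closed_ehrhart_exponents[OF cpt nonneg_convex_hull_vec_of])
      show "finite {m \<in> ehrhart_exponents ?P. snd m \<le> D}" for D
        by (rule finite_ehrhart_exponents_level[OF compact_imp_bounded[OF cpt]])
      show "\<exists>h\<in>?E. d * f ^ k = g ^ k * h" for k using fgd(7) sub by blast
    qed (use fgd sub in auto)
    then show "x \<in> to_fract ` ?E" using fgd(3,6) by auto
  next
    fix x assume "x \<in> to_fract ` ?E"
    then obtain f where f: "f \<in> ?E" "x = to_fract f" by blast
    show "x \<in> integral_closure ?R"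
      unfolding integral_closure_def f(2)
      using to_fract_in_fraction_field[OF A] integral_over_to_fract[OF integral_over_height_one_monoid_ring[OF A(1) ne f(1)] is_subring_0[OF R]]
      by blast
  }
qed

section \<open>Minimal generators of a monomial ideal\<close>

lemma mon_in_ideal_gen:
  assumes "(mon a :: ('n::finite, 'k::field) mpoly) \<in> ideal_gen (mon ` D)"
  obtains d c where "d \<in> D" "a = d + c"
proof -
  define T :: "('n, 'k) mpoly set" where "T = {f. \<forall>k\<in>Poly_Mapping.keys f. \<exists>d\<in>D. \<exists>c. k = d + c}"
  have m: "Modules.module ((*) :: ('n, 'k) mpoly \<Rightarrow> _)" by standard (auto simp: algebra_simps)
  have "module.span (*) (mon ` D) \<subseteq> T"
  proof (rule module.span_minimal[OF m])
    have "\<exists>d\<in>D. \<exists>c. k = d + c" if "k \<in> D" for k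
      using that by (intro bexI[of _ k] exI[of _ 0]) auto
    then show "mon ` D \<subseteq> T" by (auto simp: T_def Defs.mon_def)
    show "module.subspace (*) T"
    proof (rule module.subspaceI[OF m])
      show "0 \<in> T" by (simp add: T_def)
      show "x + y \<in> T" if xy: "x \<in> T" "y \<in> T" for x y
      proof -
        have "\<exists>d\<in>D. \<exists>c. k = d + c" if "k \<in> Poly_Mapping.keys (x + y)" for k
          using subsetD[OF keys_add that] xy unfolding T_def by blast
        then show ?thesis by (simp add: T_def)
      qed
      show "c * x \<in> T" if x: "x \<in> T" for c x
        unfolding T_def mem_Collect_eq
      proof
        fix k assume k: "k \<in> Poly_Mapping.keys (c * x)"
        obtain k1 k2 where k12: "k = k1 + k2" "k2 \<in> Poly_Mapping.keys x" using subsetD[OF keys_mult k] by blast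
        then obtain d e where "d \<in> D" "k2 = d + e" using x by (auto simp: T_def)
        then show "\<exists>d\<in>D. \<exists>c. k = d + c"
          using k12(1) by (intro bexI[of _ d] exI[of _ "k1 + e"]) (auto simp: ac_simps)
      qed
    qed
  qed
  then have "mon a \<in> T" using assms by (auto simp: ideal_gen_def)
  then show ?thesis using that by (auto simp: T_def Defs.mon_def)
qed

lemma mon_eq_iff: "(mon a :: ('n, 'k::field) mpoly) = mon b \<longleftrightarrow> a = b"
proof
  assume "(mon a :: ('n, 'k) mpoly) = mon b"
  then have "Poly_Mapping.keys (mon a :: ('n, 'k) mpoly) = Poly_Mapping.keys (mon b :: ('n, 'k) mpoly)" by simp
  then show "a = b" by (simp add: Defs.mon_def)
qed simp

text \<open>
  A minimal generator \<open>a\<close> is a multiple of some \<open>d \<in> D\<close>, and \<open>d\<close> is a multiple of some minimal generator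
  \<open>b\<close>.  If \<open>b \<noteq> a\<close>, then \<open>a\<close> would be redundant; so \<open>a = b = d\<close>.
\<close>

lemma minimal_monomial_generators_subset:
  fixes I :: "('n::finite, 'k::field) mpoly set"
  assumes D: "I = ideal_gen (mon ` D)" and min: "minimal_monomial_generators I (mon ` V)"
  shows "V \<subseteq> D"
proof
  fix a assume a: "a \<in> V"
  have m: "Modules.module ((*) :: ('n, 'k) mpoly \<Rightarrow> _)" by standard (auto simp: algebra_simps)
  let ?G = "mon ` V :: ('n, 'k) mpoly set"
  have I: "I = ideal_gen ?G" and least: "\<And>H. H \<subset> ?G \<Longrightarrow> ideal_gen H \<noteq> I"
    using min by (auto simp: minimal_monomial_generators_def)
  have base: "x \<in> ideal_gen S" if "x \<in> S" for x :: "('n, 'k) mpoly" and S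
    unfolding ideal_gen_def by (rule module.span_base[OF m that])
  have "mon a \<in> ideal_gen (mon ` D :: ('n, 'k) mpoly set)"
    using base[of "mon a" ?G] a I D by auto
  then obtain d c where d: "d \<in> D" "a = d + c" by (rule mon_in_ideal_gen)
  have "mon d \<in> ideal_gen ?G" using base[of "mon d" "mon ` D"] d(1) I D by auto
  then obtain b e where b: "b \<in> V" "d = b + e" by (rule mon_in_ideal_gen)
  have "b = a"
  proof (rule ccontr)
    assume "b \<noteq> a"
    define H where "H = ?G - {mon a}"
    have bH: "mon b \<in> H" using b(1) \<open>b \<noteq> a\<close> by (auto simp: H_def mon_eq_iff)
    have "(mon a :: ('n, 'k) mpoly) = mon (e + c) * mon b"
      by (simp add: Defs.mon_def mult_single d(2) b(2) ac_simps)
    then have "mon a \<in> module.span (*) H"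
      using module.span_scale[OF m module.span_base[OF m bH]] by simp
    then have "insert (mon a) H \<subseteq> module.span (*) H"
      using module.span_superset[OF m, of H] by simp
    then have "module.span (*) (insert (mon a) H) \<subseteq> module.span (*) H"
      using module.subspace_span[OF m] by (rule module.span_minimal[OF m])
    then have "module.span (*) (insert (mon a) H) = module.span (*) H"
      using module.span_mono[OF m, of H "insert (mon a) H"] by blast
    moreover have "insert (mon a) H = ?G" using a by (auto simp: H_def)
    ultimately have "ideal_gen H = I" unfolding I ideal_gen_def by simp
    moreover have "H \<subset> ?G" using a by (auto simp: H_def)
    ultimately show False using least by blast
  qed
  then have "b + (e + c) = b + 0" using d(2) b(2) by (simp add: ac_simps)
  then have ec: "e + c = 0" by (rule add_left_imp_eq)
  have "Poly_Mapping.lookup e i = 0" for i using arg_cong[OF ec, of "\<lambda>f. Poly_Mapping.lookup f i"] by (simp add: lookup_add)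
  then have "e = 0" by (intro poly_mapping_eqI) simp
  then show "a \<in> D" using d(1) b(2) \<open>b = a\<close> by simp
qed

section \<open>The generators of degree at most two\<close>

lemma total_degree_add: "total_degree (a + b) = total_degree a + total_degree b"
  by (simp add: total_degree_def lookup_add sum.distrib)

lemma total_degree_eq_0_iff: "total_degree a = 0 \<longleftrightarrow> a = 0"
  by (auto simp: total_degree_def intro: poly_mapping_eqI)

lemma total_degree_single: "total_degree (Poly_Mapping.single i n) = n"
  by (simp add: total_degree_def lookup_single when_def)

lemma split_single:
  assumes "Poly_Mapping.lookup a i \<noteq> (0::nat)"
  obtains b where "a = b + Poly_Mapping.single i 1"
proof
  show "a = (a - Poly_Mapping.single i 1) + Poly_Mapping.single i 1"
    using assms by (intro poly_mapping_eqI) (auto simp: lookup_add lookup_minus lookup_single when_def)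
qed

lemma total_degree_Suc:
  assumes "total_degree a = Suc n"
  obtains i b where "a = b + Poly_Mapping.single i 1" "total_degree b = n"
proof -
  obtain i where i: "Poly_Mapping.lookup a i \<noteq> 0"
    using assms unfolding total_degree_def by (metis nat.distinct(1) sum.neutral)
  from split_single[OF this] obtain b where "a = b + Poly_Mapping.single i 1" .
  then show ?thesis using assms that by (simp add: total_degree_add total_degree_single)
qed

definition generators :: "nat \<Rightarrow> (nat \<Rightarrow> ('n \<Rightarrow>\<^sub>0 nat)) \<Rightarrow> ('n \<Rightarrow>\<^sub>0 nat) set" where
  "generators q v = {0} \<union> range (\<lambda>i. Poly_Mapping.single i 1) \<union> v ` {..<q}"

lemma finite_generators: "finite (generators q (v :: nat \<Rightarrow> ('n::finite \<Rightarrow>\<^sub>0 nat)))"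
  by (simp add: generators_def)

lemma generators_mem:
  shows "0 \<in> generators q v" "Poly_Mapping.single i 1 \<in> generators q v" "j < q \<Longrightarrow> v j \<in> generators q v"
  by (auto simp: generators_def)

lemma \<B>_eq: "\<B> q v = (\<lambda>a. (vec_of a, 1)) ` generators q v"
  by (simp only: \<B>_def generators_def image_Un image_insert image_empty image_image vec_of_single vec_of_0) auto

lemma \<Q>_eq: "\<Q> q v = convex hull (vec_of ` generators q v)"
proof -
  have "{0} \<union> {axis i 1 | i. True} \<union> {vec_of (v j) | j. j < q} = vec_of ` generators q v"
    by (simp only: generators_def image_Un image_insert image_empty image_image vec_of_single vec_of_0) auto
  then show ?thesis by (simp only: \<Q>_def)
qed

text \<open>
  The exponents of \<open>K[\<nat>\<B>]\<close> and of the Ehrhart ring of \<open>\<Q>\<close>.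
\<close>

abbreviation "lattice_monoid q v \<equiv> height_one_monoid (generators q v)"
abbreviation "cone_monoid q v \<equiv> ehrhart_exponents (\<Q> q v)"

section \<open>Downward closure\<close>

text \<open>
  Being able to subtract a unit \<open>e\<^sub>i\<close> whenever it occurs is a property of the generators that passes to
  sums, because a unit that occurs in a sum occurs in one of the summands.
\<close>

lemma height_one_monoid_downward_step:
  assumes A: "finite A" and down: "\<And>b i. b + Poly_Mapping.single i 1 \<in> A \<Longrightarrow> b \<in> A"
    and m: "(b + Poly_Mapping.single i 1, t) \<in> height_one_monoid A"
  shows "(b, t) \<in> height_one_monoid A"
proof -
  let ?H = "height_one_monoid A"
  note H = submonoid_height_one_monoid[OF A]
  have H_add: "(x + x', s + s') \<in> ?H" if "(x, s) \<in> ?H" "(x', s') \<in> ?H" for x x' s s'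
  proof -
    have "(x, s) + (x', s') \<in> ?H" using H that unfolding add_submonoid_def by blast
    then show ?thesis by simp
  qed
  \<comment> \<open>The elements from which every occurring unit can be subtracted.\<close>
  define N where "N = {(a, t) \<in> ?H. \<forall>b i. a = b + Poly_Mapping.single i 1 \<longrightarrow> (b, t) \<in> ?H}"
  have nz: "(0 :: 'a \<Rightarrow>\<^sub>0 nat) \<noteq> b + Poly_Mapping.single i 1" for b i
  proof
    assume eq: "0 = b + Poly_Mapping.single i (1::nat)"
    have "total_degree (b + Poly_Mapping.single i 1) = 0" unfolding eq[symmetric] total_degree_eq_0_iff ..
    then show False unfolding total_degree_add total_degree_single by simp
  qed
  have "add_submonoid N"
    unfolding add_submonoid_def
  proof (intro conjI ballI)
    show "0 \<in> N" using H nz by (auto simp: N_def add_submonoid_def zero_prod_def)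
  next
    fix m m' assume m: "m \<in> N" "m' \<in> N"
    obtain a t a' t' where [simp]: "m = (a, t)" "m' = (a', t')" by (cases m, cases m') auto
    have mem: "(a, t) \<in> ?H" "(a', t') \<in> ?H" using m by (auto simp: N_def)
    have "(b, t + t') \<in> ?H" if eq: "a + a' = b + Poly_Mapping.single i 1" for b i
    proof -
      have "Poly_Mapping.lookup a i \<noteq> 0 \<or> Poly_Mapping.lookup a' i \<noteq> 0"
        using arg_cong[OF eq, of "\<lambda>f. Poly_Mapping.lookup f i"] by (auto simp: lookup_add)
      then show ?thesis
      proof
        assume "Poly_Mapping.lookup a i \<noteq> 0"
        then obtain c where c: "a = c + Poly_Mapping.single i 1" by (rule split_single)
        have "b + Poly_Mapping.single i 1 = (c + a') + Poly_Mapping.single i 1"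
          using eq c by (simp add: ac_simps)
        then have b: "b = c + a'" by (rule add_right_imp_eq)
        have "(c, t) \<in> ?H" using m(1) c by (auto simp: N_def)
        then show ?thesis unfolding b by (rule H_add) (rule mem(2))
      next
        assume "Poly_Mapping.lookup a' i \<noteq> 0"
        then obtain c where c: "a' = c + Poly_Mapping.single i 1" by (rule split_single)
        have "b + Poly_Mapping.single i 1 = (a + c) + Poly_Mapping.single i 1"
          using eq c by (simp add: ac_simps)
        then have b: "b = a + c" by (rule add_right_imp_eq)
        have "(c, t') \<in> ?H" using m(2) c by (auto simp: N_def)
        then show ?thesis unfolding b by (rule H_add[OF mem(1)])
      qed
    qed
    then show "m + m' \<in> N" using H_add[OF mem] by (auto simp: N_def)
  qed
  then have "?H \<subseteq> N"
    by (rule height_one_monoid_least[OF A])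
       (use down in \<open>auto simp: N_def intro: generator_in_height_one_monoid[OF A, simplified]\<close>)
  then show ?thesis using m by (auto simp: N_def)
qed

lemma height_one_monoid_downward_closed:
  assumes A: "finite A" and down: "\<And>b i. b + Poly_Mapping.single i 1 \<in> A \<Longrightarrow> b \<in> A"
  shows "(b + c, t) \<in> height_one_monoid A \<Longrightarrow> (b, t) \<in> height_one_monoid A"
proof (induction "total_degree c" arbitrary: c)
  case 0 then show ?case by (simp add: total_degree_eq_0_iff)
next
  case (Suc n)
  from total_degree_Suc[OF Suc(2)[symmetric]] obtain i d
    where d: "c = d + Poly_Mapping.single i 1" "total_degree d = n" .
  have "(b + d + Poly_Mapping.single i 1, t) \<in> height_one_monoid A" using Suc(3) d(1) by (simp add: ac_simps)
  from height_one_monoid_downward_step[OF A down this] have "(b + d, t) \<in> height_one_monoid A" .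
  then show ?case using Suc(1) d(2) by blast
qed

lemma generators_downward_closed:
  assumes deg: "\<forall>j<q. total_degree (v j) = 2" and b: "b + Poly_Mapping.single i 1 \<in> generators q v"
  shows "b \<in> generators q v"
proof -
  have "total_degree (b + Poly_Mapping.single i 1) \<le> 2"
    using b deg by (auto simp: generators_def total_degree_single total_degree_eq_0_iff[THEN iffD2] simp del: One_nat_def)
  then consider "total_degree b = 0" | "total_degree b = Suc 0"
    unfolding total_degree_add total_degree_single by linarith
  then show ?thesis
  proof cases
    case 1 then show ?thesis by (simp add: total_degree_eq_0_iff generators_mem)
  next
    case 2
    from total_degree_Suc[OF 2] obtain k c where "b = c + Poly_Mapping.single k 1" "total_degree c = 0" .
    then show ?thesis using generators_mem(2)[of k q v] by (simp add: total_degree_eq_0_iff)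
  qed
qed

text \<open>
  The missing weight goes to \<open>0\<close>; in the cone over \<open>P\<close> this is the addition of \<open>(0, 1 - u - w)\<close>.
\<close>

lemma convex_combination_with_0:
  assumes "convex P" "0 \<in> P" "x \<in> P" "y \<in> P" "0 \<le> u" "0 \<le> w" "u + w \<le> 1"
  shows "u *\<^sub>R x + w *\<^sub>R y \<in> P"
proof -
  have mem: "(z, 1) \<in> height_cone P" if "z \<in> P" for z using that by (simp add: height_cone_iff)
  have "u *\<^sub>R (x, 1) + w *\<^sub>R (y, 1) + (1 - u - w) *\<^sub>R (0, 1) \<in> height_cone P"
    by (intro height_cone_add height_cone_scale mem assms) (use assms in auto)
  then show ?thesis by (simp add: height_cone_iff)
qed

definition coord_scale :: "('n \<Rightarrow> real) \<Rightarrow> real ^ 'n \<Rightarrow> real ^ 'n::finite" where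
  "coord_scale th x = (\<chi> i. th i * (x $ i))"

lemma linear_coord_scale: "linear (coord_scale th)"
  by (rule linearI) (simp_all add: coord_scale_def Finite_Cartesian_Product.vec_eq_iff algebra_simps)

lemma coord_scale_axis: "coord_scale th (axis i 1) = th i *\<^sub>R axis i 1"
  by (simp add: coord_scale_def Finite_Cartesian_Product.vec_eq_iff axis_def)

text \<open>
  By linearity only the generators matter.  For \<open>v\<^sub>j = e\<^sub>k + e\<^sub>l\<close> with
  \<open>\<theta>\<^sub>k \<le> \<theta>\<^sub>l\<close>, the scaled vector is the combination
  \<open>\<theta>\<^sub>k v\<^sub>j + (\<theta>\<^sub>l - \<theta>\<^sub>k) e\<^sub>l + (1 - \<theta>\<^sub>l) 0\<close>; this is where degree \<open>2\<close> is used.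
\<close>

lemma \<Q>_coord_scale:
  fixes v :: "nat \<Rightarrow> ('n::finite \<Rightarrow>\<^sub>0 nat)"
  assumes deg: "\<forall>j<q. total_degree (v j) = 2" and th: "\<And>i. 0 \<le> th i" "\<And>i. th i \<le> 1"
    and x: "x \<in> \<Q> q v"
  shows "coord_scale th x \<in> \<Q> q v"
proof -
  have conv: "convex (\<Q> q v)" unfolding \<Q>_def by (rule convex_convex_hull)
  have gen: "vec_of a \<in> \<Q> q v" if "a \<in> generators q v" for a
    unfolding \<Q>_eq using that by (intro hull_inc) auto
  have zero: "0 \<in> \<Q> q v" using gen[OF generators_mem(1)] by simp
  have ax: "axis i 1 \<in> \<Q> q v" for i using gen[OF generators_mem(2)[of i]] unfolding vec_of_single .
  have two: "coord_scale th (axis k 1 + axis l 1) \<in> \<Q> q v"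
    if kl: "axis k 1 + axis l 1 \<in> \<Q> q v" "th k \<le> th l" for k l
  proof -
    have "coord_scale th (axis k 1 + axis l 1) = th k *\<^sub>R (axis k 1 + axis l 1) + (th l - th k) *\<^sub>R axis l 1"
      unfolding linear_add[OF linear_coord_scale] coord_scale_axis by (simp add: algebra_simps)
    also have "\<dots> \<in> \<Q> q v"
      by (intro convex_combination_with_0 conv zero kl ax) (use kl th in auto)
    finally show ?thesis .
  qed
  have "coord_scale th (vec_of a) \<in> \<Q> q v" if a: "a \<in> generators q v" for a
  proof -
    consider "a = 0" | i where "a = Poly_Mapping.single i 1" | j where "j < q" "a = v j"
      using a by (auto simp: generators_def)
    then show ?thesis
    proof cases
      case 1 then show ?thesis using zero by (simp add: linear_0[OF linear_coord_scale])
    next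
      case (2 i)
      have "th i *\<^sub>R axis i 1 + 0 *\<^sub>R 0 \<in> \<Q> q v"
        by (intro convex_combination_with_0 conv zero ax) (use th in auto)
      then show ?thesis unfolding 2 vec_of_single coord_scale_axis by simp
    next
      case (3 j)
      have "total_degree a = Suc 1" using deg 3 by simp
      from total_degree_Suc[OF this] obtain l b where l: "a = b + Poly_Mapping.single l 1" "total_degree b = 1" .
      from l(2) have "total_degree b = Suc 0" by simp
      from total_degree_Suc[OF this] obtain k c where k: "b = c + Poly_Mapping.single k 1" "total_degree c = 0" .
      have eq: "vec_of a = axis k 1 + axis l 1"
        using k(2) unfolding l(1) k(1) vec_of_add vec_of_single by (simp add: total_degree_eq_0_iff)
      note mem = gen[OF a, unfolded eq]
      show ?thesis unfolding eq
      proof (cases "th k \<le> th l")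
        case True then show "coord_scale th (axis k 1 + axis l 1) \<in> \<Q> q v" using two mem by blast
      next
        case False
        then have "coord_scale th (axis l 1 + axis k 1) \<in> \<Q> q v" using mem by (intro two) (auto simp: add.commute)
        then show "coord_scale th (axis k 1 + axis l 1) \<in> \<Q> q v" by (simp only: add.commute)
      qed
    qed
  qed
  then have "coord_scale th ` (vec_of ` generators q v) \<subseteq> \<Q> q v" by auto
  then have "convex hull (coord_scale th ` (vec_of ` generators q v)) \<subseteq> \<Q> q v" using conv by (rule hull_minimal)
  then have "coord_scale th ` \<Q> q v \<subseteq> \<Q> q v"
    unfolding convex_hull_linear_image[OF linear_coord_scale, symmetric] \<Q>_eq[symmetric] .
  then show ?thesis using x by blast
qed

text \<open>
  A vector below \<open>w = A y\<close> arises from \<open>w\<close> by scaling the coordinates with factors in \<open>[0, 1]\<close>.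
\<close>

lemma cone_monoid_if_covered:
  fixes v :: "nat \<Rightarrow> ('n::finite \<Rightarrow>\<^sub>0 nat)" and y :: "nat \<Rightarrow> real"
  assumes deg: "\<forall>j<q. total_degree (v j) = 2" and y: "\<forall>j<q. 0 \<le> y j" "(\<Sum>j<q. y j) \<le> real b"
    and a: "\<And>i. real (Poly_Mapping.lookup a i) \<le> (\<Sum>j<q. real (Poly_Mapping.lookup (v j) i) * y j)"
  shows "(a, b) \<in> cone_monoid q v"
proof -
  let ?C = "height_cone (\<Q> q v)"
  have conv: "convex (\<Q> q v)" unfolding \<Q>_def by (rule convex_convex_hull)
  have gen: "(vec_of a, 1) \<in> ?C" if "a \<in> generators q v" for a
    unfolding height_cone_iff \<Q>_eq using that by (auto intro: hull_inc)
  have ne: "\<Q> q v \<noteq> {}" unfolding \<Q>_def by auto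
  define w where "w = (\<Sum>j<q. y j *\<^sub>R vec_of (v j))"
  have "(\<Sum>j<q. y j *\<^sub>R (vec_of (v j), 1)) + (real b - (\<Sum>j<q. y j)) *\<^sub>R (vec_of 0, 1) \<in> ?C"
    by (intro height_cone_add height_cone_sum height_cone_scale conv ne gen generators_mem) (use y in auto)
  also have "(\<Sum>j<q. y j *\<^sub>R (vec_of (v j), 1)) + (real b - (\<Sum>j<q. y j)) *\<^sub>R (vec_of 0, 1) = (w, real b)"
    by (simp add: w_def prod_eq_iff fst_sum snd_sum)
  finally obtain x where x: "x \<in> \<Q> q v" "w = real b *\<^sub>R x" by (auto simp: height_cone_iff)
  have w: "real (Poly_Mapping.lookup a i) \<le> w $ i" for i
    using a[of i] by (simp add: w_def mult.commute)
  \<comment> \<open>Where \<open>w\<close> vanishes so does \<open>a\<close>, and the quotient is \<open>0 / 0 = 0\<close>.\<close>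
  define th where "th i = real (Poly_Mapping.lookup a i) / w $ i" for i
  have "coord_scale th x \<in> \<Q> q v"
  proof (rule \<Q>_coord_scale[OF deg _ _ x(1)])
    have w0: "0 \<le> w $ i" for i by (rule order_trans[OF of_nat_0_le_iff w])
    show "0 \<le> th i" for i using w0[of i] by (simp add: th_def)
    show "th i \<le> 1" for i using w0[of i] w[of i] by (cases "w $ i = 0") (auto simp: th_def divide_le_eq_1)
  qed
  moreover have "vec_of a = real b *\<^sub>R coord_scale th x"
  proof -
    have "vec_of a = coord_scale th w"
      using w by (auto simp: coord_scale_def th_def Finite_Cartesian_Product.vec_eq_iff) (metis of_nat_le_0_iff order_antisym_conv of_nat_0_le_iff of_nat_0)
    then show ?thesis unfolding x(2) linear_scale[OF linear_coord_scale] .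
  qed
  ultimately show ?thesis by (auto simp: ehrhart_exponents_def)
qed

text \<open>
  The combination of the \<open>v\<^sub>j\<close>, raised to height \<open>b\<close> by copies of \<open>(0, 1)\<close>, lies above \<open>a\<close>, and the
  monoid is closed downwards.
\<close>

lemma lattice_monoid_if_covered:
  fixes v :: "nat \<Rightarrow> ('n::finite \<Rightarrow>\<^sub>0 nat)" and y :: "nat \<Rightarrow> nat"
  assumes deg: "\<forall>j<q. total_degree (v j) = 2" and y: "(\<Sum>j<q. y j) \<le> b"
    and a: "\<And>i. Poly_Mapping.lookup a i \<le> (\<Sum>j<q. Poly_Mapping.lookup (v j) i * y j)"
  shows "(a, b) \<in> lattice_monoid q v"
proof -
  note fin = finite_generators[of q v]
  note H = submonoid_height_one_monoid[OF fin]
  define w where "w = (\<Sum>j<q. \<Sum>k<y j. v j)"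
  have lw: "Poly_Mapping.lookup w i = (\<Sum>j<q. Poly_Mapping.lookup (v j) i * y j)" for i
    by (simp add: w_def lookup_sum mult.commute)
  have "(\<Sum>j<q. \<Sum>k<y j. (v j, 1)) + (0, b - (\<Sum>j<q. y j)) \<in> lattice_monoid q v"
  proof -
    have "(\<Sum>j<q. \<Sum>k<y j. (v j, 1)) \<in> lattice_monoid q v"
      by (intro add_submonoid_sum[OF H] generator_in_height_one_monoid[OF fin] generators_mem) simp
    then show ?thesis using zero_level_in_height_one_monoid[OF fin generators_mem(1)] H
      unfolding add_submonoid_def by blast
  qed
  also have "(\<Sum>j<q. \<Sum>k<y j. (v j, 1)) + (0, b - (\<Sum>j<q. y j)) = (w, b)"
    using y by (simp add: w_def prod_eq_iff fst_sum snd_sum)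
  also have "w = a + (w - a)"
    using a by (intro poly_mapping_eqI) (simp add: lookup_add lookup_minus lw)
  finally show ?thesis
    by (rule height_one_monoid_downward_closed[OF fin, rotated]) (rule generators_downward_closed[OF deg])
qed

section \<open>Combinations of generators and covers\<close>

text \<open>
  The three kinds of generators do not overlap, because their degrees are \<open>0\<close>, \<open>1\<close> and \<open>2\<close>.
\<close>

lemma sum_generators:
  fixes f :: "('n::finite \<Rightarrow>\<^sub>0 nat) \<Rightarrow> 'b::comm_monoid_add"
  assumes deg: "\<forall>j<q. total_degree (v j) = 2" and inj: "inj_on v {..<q}"
  shows "sum f (generators q v) = f 0 + (\<Sum>i\<in>UNIV. f (Poly_Mapping.single i 1)) + (\<Sum>j<q. f (v j))"
proof -
  let ?e = "\<lambda>i. Poly_Mapping.single i 1 :: 'n \<Rightarrow>\<^sub>0 nat"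
  have te: "total_degree (?e i) = 1" for i by (rule total_degree_single)
  have t0: "total_degree (0 :: 'n \<Rightarrow>\<^sub>0 nat) = 0" by (simp add: total_degree_eq_0_iff)
  have d: "({0} \<union> range ?e) \<inter> v ` {..<q} = {}" "{0} \<inter> range ?e = {}"
  proof -
    have "total_degree x < 2" if "x \<in> {0} \<union> range ?e" for x using that te t0 by (auto simp del: One_nat_def)
    moreover have "total_degree x = 2" if "x \<in> v ` {..<q}" for x using that deg by auto
    ultimately show "({0} \<union> range ?e) \<inter> v ` {..<q} = {}" by (metis disjoint_iff less_irrefl)
    have "?e i \<noteq> 0" for i
    proof
      assume "?e i = 0"
      then have "total_degree (?e i) = 0" unfolding total_degree_eq_0_iff .
      then show False unfolding te by simp
    qed
    then show "{0} \<inter> range ?e = {}" by (auto simp del: One_nat_def)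
  qed
  have "inj ?e"
  proof (rule injI)
    fix x y assume "?e x = ?e y"
    then have "Poly_Mapping.keys (?e x) = Poly_Mapping.keys (?e y)" by simp
    then show "x = y" by simp
  qed
  then have "sum f (range ?e) = (\<Sum>i\<in>UNIV. f (?e i))" by (simp only: sum.reindex o_def)
  moreover have "sum f (v ` {..<q}) = (\<Sum>j<q. f (v j))" using inj by (simp only: sum.reindex o_def)
  moreover have "sum f ({0} \<union> range ?e) = sum f {0} + sum f (range ?e)"
    by (rule sum.union_disjoint) (use d(2) in auto)
  moreover have "sum f (generators q v) = sum f ({0} \<union> range ?e) + sum f (v ` {..<q})"
    unfolding generators_def by (rule sum.union_disjoint) (use d(1) in auto)
  ultimately show ?thesis by simp
qed

lemma cone_monoid_coeffs:
  fixes v :: "nat \<Rightarrow> ('n::finite \<Rightarrow>\<^sub>0 nat)"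
  assumes deg: "\<forall>j<q. total_degree (v j) = 2" and inj: "inj_on v {..<q}" and m: "(a, b) \<in> cone_monoid q v"
  obtains mu y where "\<forall>i. 0 \<le> mu i" "\<forall>j<q. 0 \<le> y j"
    "\<forall>i. real (Poly_Mapping.lookup a i) = mu i + (\<Sum>j<q. real (Poly_Mapping.lookup (v j) i) * y j)"
    "sum mu UNIV + (\<Sum>j<q. y j) \<le> real b"
proof -
  note sg = sum_generators[OF deg inj]
  obtain l where l: "\<forall>a\<in>generators q v. 0 \<le> l a"
    "nat_exp (a, b) = (\<Sum>a\<in>generators q v. l a *\<^sub>R nat_exp (a, 1))"
    by (rule height_cone_convex_hull_coeffs[OF finite_generators m[unfolded \<Q>_eq]])
  define mu y where "mu i = l (Poly_Mapping.single i 1)" and "y j = l (v j)" for i j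
  have "real b = (\<Sum>a\<in>generators q v. l a)"
    using arg_cong[OF l(2), of snd] by (simp add: nat_exp_def snd_sum)
  also have "\<dots> = l 0 + (sum mu UNIV + (\<Sum>j<q. y j))" unfolding sg by (simp add: mu_def y_def)
  finally have "sum mu UNIV + (\<Sum>j<q. y j) \<le> real b" using bspec[OF l(1) generators_mem(1)] by simp
  moreover have "real (Poly_Mapping.lookup a i) = mu i + (\<Sum>j<q. real (Poly_Mapping.lookup (v j) i) * y j)" for i
  proof -
    have "real (Poly_Mapping.lookup a i) = (\<Sum>a\<in>generators q v. l a * real (Poly_Mapping.lookup a i))"
      using arg_cong[OF l(2), of "\<lambda>x. fst x $ i"] by (simp add: nat_exp_def fst_sum)
    also have "\<dots> = (\<Sum>k\<in>UNIV. if k = i then mu k else 0) + (\<Sum>j<q. real (Poly_Mapping.lookup (v j) i) * y j)"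
      unfolding sg by (simp add: mu_def y_def lookup_single when_def mult.commute if_distrib[of real] if_distrib[of "\<lambda>x. x * _"] if_distrib[of "\<lambda>x. _ * x"] cong: if_cong)
    finally show ?thesis by simp
  qed
  moreover have "0 \<le> mu i" for i unfolding mu_def by (intro bspec[OF l(1)] generators_mem)
  moreover have "0 \<le> y j" if "j < q" for j unfolding y_def by (intro bspec[OF l(1)] generators_mem that)
  ultimately show ?thesis by (intro that[of mu y]) auto
qed

lemma lattice_monoid_coeffs:
  fixes v :: "nat \<Rightarrow> ('n::finite \<Rightarrow>\<^sub>0 nat)"
  assumes deg: "\<forall>j<q. total_degree (v j) = 2" and inj: "inj_on v {..<q}" and m: "(a, b) \<in> lattice_monoid q v"
  obtains n y where
    "\<forall>i. Poly_Mapping.lookup a i = n i + (\<Sum>j<q. Poly_Mapping.lookup (v j) i * y j)"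
    "sum n UNIV + (\<Sum>j<q. y j) \<le> b"
proof -
  note sg = sum_generators[OF deg inj]
  obtain c :: "_ \<Rightarrow> nat" where c: "(a, b) = (\<Sum>a\<in>generators q v. \<Sum>i<c a. (a, 1))"
    using m unfolding height_one_monoid_eq[OF finite_generators] by blast
  define n y where "n i = c (Poly_Mapping.single i 1)" and "y j = c (v j)" for i j
  have "b = (\<Sum>a\<in>generators q v. c a)"
    using arg_cong[OF c, of snd] by (simp add: snd_sum)
  also have "\<dots> = c 0 + (sum n UNIV + (\<Sum>j<q. y j))" unfolding sg by (simp add: n_def y_def)
  finally have "sum n UNIV + (\<Sum>j<q. y j) \<le> b" by simp
  moreover have "Poly_Mapping.lookup a i = n i + (\<Sum>j<q. Poly_Mapping.lookup (v j) i * y j)" for i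
  proof -
    have "Poly_Mapping.lookup a i = (\<Sum>a\<in>generators q v. c a * Poly_Mapping.lookup a i)"
      using arg_cong[OF c, of "\<lambda>x. Poly_Mapping.lookup (fst x) i"] by (simp add: fst_sum lookup_sum)
    also have "\<dots> = (\<Sum>k\<in>UNIV. if k = i then n k else 0) + (\<Sum>j<q. Poly_Mapping.lookup (v j) i * y j)"
      unfolding sg by (simp add: n_def y_def lookup_single when_def mult.commute if_distrib[of "\<lambda>x. x * _"] if_distrib[of "\<lambda>x. _ * x"] cong: if_cong)
    finally show ?thesis by simp
  qed
  ultimately show ?thesis by (intro that[of n y]) auto
qed

text \<open>
  Each unit \<open>e\<^sub>i\<close> with \<open>i \<in> C\<close> is replaced by a column of the matrix that has a positive entry in row \<open>i\<close>.
  This keeps the sum of the coefficients and does not decrease the combination.  It is needed for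
  real and for natural coefficients.
\<close>

lemma absorb_units:
  fixes mu :: "'i::finite \<Rightarrow> 'b::linordered_semidom" and y :: "nat \<Rightarrow> 'b" and A :: "'i \<Rightarrow> nat \<Rightarrow> nat"
  assumes mu: "\<forall>i. 0 \<le> mu i" and y: "\<forall>j<q. 0 \<le> y j" and C: "\<forall>i\<in>C. \<exists>j<q. A i j \<noteq> 0"
  obtains y' where "\<forall>j<q. 0 \<le> y' j" "(\<Sum>j<q. y' j) = (\<Sum>j<q. y j) + sum mu C"
    "\<forall>i. (\<Sum>j<q. of_nat (A i j) * y j) \<le> (\<Sum>j<q. of_nat (A i j) * y' j)"
    "\<forall>i\<in>C. mu i + (\<Sum>j<q. of_nat (A i j) * y j) \<le> (\<Sum>j<q. of_nat (A i j) * y' j)"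
proof -
  obtain J where J: "\<And>i. i \<in> C \<Longrightarrow> J i < q" "\<And>i. i \<in> C \<Longrightarrow> A i (J i) \<noteq> 0"
    using bchoice[OF C] by auto
  define s where "s j = (\<Sum>i\<in>{i \<in> C. J i = j}. mu i)" for j
  have s0: "0 \<le> s j" for j unfolding s_def by (intro sum_nonneg mu[rule_format])
  define y' where "y' j = y j + s j" for j
  have split: "(\<Sum>j<q. of_nat (A i j) * y' j) = (\<Sum>j<q. of_nat (A i j) * y j) + (\<Sum>j<q. of_nat (A i j) * s j)" for i
    by (simp add: y'_def distrib_left sum.distrib)
  have nn: "0 \<le> (\<Sum>j<q. of_nat (A i j) * s j)" for i by (intro sum_nonneg mult_nonneg_nonneg s0) auto
  have "mu i \<le> (\<Sum>j<q. of_nat (A i j) * s j)" if i: "i \<in> C" for i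
  proof -
    have "mu i \<le> s (J i)" unfolding s_def using i mu by (intro member_le_sum) auto
    also have "\<dots> = of_nat 1 * s (J i)" by simp
    also have "\<dots> \<le> of_nat (A i (J i)) * s (J i)"
      using J(2)[OF i] by (intro mult_right_mono s0 of_nat_mono) simp
    also have "\<dots> \<le> (\<Sum>j<q. of_nat (A i j) * s j)"
      using J(1)[OF i] by (intro member_le_sum[of _ _ "\<lambda>j. of_nat (A i j) * s j"]) (auto simp: s0)
    finally show ?thesis .
  qed
  then have 4: "mu i + (\<Sum>j<q. of_nat (A i j) * y j) \<le> (\<Sum>j<q. of_nat (A i j) * y' j)" if "i \<in> C" for i
    using that unfolding split by (simp add: add.commute)
  have 2: "(\<Sum>j<q. y' j) = (\<Sum>j<q. y j) + sum mu C"
  proof -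
    have "(\<Sum>j<q. s j) = sum mu C"
      unfolding s_def by (rule sum.group) (use J(1) in auto)
    then show ?thesis by (simp add: y'_def sum.distrib)
  qed
  have 1: "0 \<le> y' j" if "j < q" for j using y that s0 by (simp add: y'_def)
  have 3: "(\<Sum>j<q. of_nat (A i j) * y j) \<le> (\<Sum>j<q. of_nat (A i j) * y' j)" for i
    using nn unfolding split by simp
  show ?thesis by (rule that[of y']) (use 1 2 3 4 in auto)
qed

text \<open>
  Only solutions with sum of coefficients at most that of \<open>y0\<close> compete; once their unused
  coordinates are set to \<open>0\<close>, they form a compact set in the product topology.
\<close>

lemma covers_attains_minimum:
  assumes y0: "covers q A \<alpha> y0"
  shows "\<exists>m\<in>real_values q A \<alpha>. \<forall>r\<in>real_values q A \<alpha>. m \<le> r"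
proof -
  define b where "b = (\<Sum>j<q. y0 j)"
  define K where "K = (PiE UNIV (\<lambda>j. if j < q then {0..b} else {0}) :: (nat \<Rightarrow> real) set)"
  have "compactin (product_topology (\<lambda>_. euclidean) UNIV) K"
    unfolding K_def compactin_PiE by (simp add: compactin_euclidean_iff)
  then have K: "compact K" by (simp add: euclidean_product_topology compactin_euclidean_iff)
  have "closed {y :: nat \<Rightarrow> real. \<forall>i. real_of_int (\<alpha> i) \<le> (\<Sum>j<q. real_of_int (A i j) * y j)}"
    by (intro closed_Collect_all closed_Collect_le continuous_intros continuous_on_product_coordinates)
  then have F: "compact (K \<inter> {y. \<forall>i. real_of_int (\<alpha> i) \<le> (\<Sum>j<q. real_of_int (A i j) * y j)})" (is "compact ?F")
    by (rule compact_Int_closed[OF K])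
  define trunc where "trunc y j = (if j < q then y j else 0)" for y :: "nat \<Rightarrow> real" and j
  have trunc: "trunc y \<in> ?F" if y: "covers q A \<alpha> y" "(\<Sum>j<q. y j) \<le> b" for y
  proof -
    have "y j \<le> b" if "j < q" for j
    proof -
      have "y j \<le> (\<Sum>j<q. y j)" using y(1) that by (intro member_le_sum) (auto simp: covers_def)
      then show ?thesis using y(2) by simp
    qed
    then have "trunc y \<in> K" using y(1) by (auto simp: K_def trunc_def covers_def)
    moreover have "(\<Sum>j<q. real_of_int (A i j) * trunc y j) = (\<Sum>j<q. real_of_int (A i j) * y j)" for i
      by (intro sum.cong) (auto simp: trunc_def)
    ultimately show ?thesis using y(1) by (simp add: covers_def)
  qed
  have sum_trunc: "(\<Sum>j<q. trunc y j) = (\<Sum>j<q. y j)" for y by (intro sum.cong) (auto simp: trunc_def)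
  have ne: "?F \<noteq> {}" using trunc[OF y0] by (auto simp: b_def)
  have "continuous_on ?F (\<lambda>y. \<Sum>j<q. y j)"
    by (intro continuous_intros continuous_on_product_coordinates continuous_on_subset[OF continuous_on_product_coordinates]) auto
  from continuous_attains_inf[OF F ne this] obtain y1
    where y1: "y1 \<in> ?F" "\<And>y. y \<in> ?F \<Longrightarrow> (\<Sum>j<q. y1 j) \<le> (\<Sum>j<q. y j)" by blast
  have "y1 j \<in> (if j < q then {0..b} else {0})" for j
    using y1(1) PiE_mem[of y1 UNIV "\<lambda>j. if j < q then {0..b} else {0}" j] by (simp add: K_def)
  then have "0 \<le> y1 j" if "j < q" for j using that by (metis atLeastAtMost_iff)
  then have c1: "covers q A \<alpha> y1" using y1(1) by (auto simp: covers_def)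
  have "(\<Sum>j<q. y1 j) \<le> (\<Sum>j<q. y j)" if y: "covers q A \<alpha> y" for y
  proof (cases "(\<Sum>j<q. y j) \<le> b")
    case True then show ?thesis using y1(2)[OF trunc[OF y]] sum_trunc by simp
  next
    case False then show ?thesis using y1(2)[OF trunc[OF y0]] sum_trunc[of y0] by (simp add: b_def)
  qed
  then show ?thesis using c1 unfolding real_values_def by blast
qed

section \<open>Integer rounding\<close>

lemma covers_incidence_matrix_iff:
  "covers q (incidence_matrix v) \<alpha> y \<longleftrightarrow> (\<forall>j<q. 0 \<le> y j) \<and>
     (\<forall>i. real_of_int (\<alpha> i) \<le> (\<Sum>j<q. real (Poly_Mapping.lookup (v j) i) * y j))"
  by (simp add: covers_def incidence_matrix_def)

text \<open>
  Let \<open>C\<close> be the set of coordinates that occur in some \<open>v\<^sub>j\<close>.  Outside of \<open>C\<close> an exponent in the cone is a sum of units with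
  integer coefficients, which can be split off together with their height.  On \<open>C\<close> the units are absorbed into the
  \<open>v\<^sub>j\<close>, giving a real solution of the covering program; rounding provides an integral one of
  no greater height.
\<close>

lemma integer_rounding_imp_cone_subset_lattice:
  fixes v :: "nat \<Rightarrow> ('n::finite \<Rightarrow>\<^sub>0 nat)"
  assumes deg: "\<forall>j<q. total_degree (v j) = 2" and inj: "inj_on v {..<q}"
    and round: "integer_rounding q (incidence_matrix v)"
  shows "cone_monoid q v \<subseteq> lattice_monoid q v"
proof
  fix m assume m: "m \<in> cone_monoid q v"
  obtain a b where ab: "m = (a, b)" by force
  obtain mu y where mu: "\<forall>i. 0 \<le> mu i" and y: "\<forall>j<q. 0 \<le> y j"
    and a: "\<forall>i. real (Poly_Mapping.lookup a i) = mu i + (\<Sum>j<q. real (Poly_Mapping.lookup (v j) i) * y j)"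
    and b: "sum mu UNIV + (\<Sum>j<q. y j) \<le> real b"
    by (rule cone_monoid_coeffs[OF deg inj m[unfolded ab]])
  define C where "C = {i. \<exists>j<q. Poly_Mapping.lookup (v j) i \<noteq> 0}"
  have a_unc: "real (Poly_Mapping.lookup a i) = mu i" if "i \<notin> C" for i
    using a that by (simp add: C_def)
  \<comment> \<open>The part of \<open>a\<close> supported outside \<open>C\<close>; its height in the monoid is its total degree.\<close>
  define aU where "aU = (\<Sum>i\<in>-C. Poly_Mapping.single i (Poly_Mapping.lookup a i))"
  have aU: "Poly_Mapping.lookup aU i = (if i \<in> C then 0 else Poly_Mapping.lookup a i)" for i
  proof -
    have "Poly_Mapping.lookup aU i = (\<Sum>k\<in>-C. if k = i then Poly_Mapping.lookup a i else 0)"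
      unfolding aU_def lookup_sum by (intro sum.cong) (auto simp: lookup_single when_def)
    then show ?thesis by simp
  qed
  define aC where "aC = a - aU"
  have aC: "Poly_Mapping.lookup aC i = (if i \<in> C then Poly_Mapping.lookup a i else 0)" for i
    by (simp add: aC_def lookup_minus aU)
  have split: "a = aC + aU" by (intro poly_mapping_eqI) (simp add: lookup_add aC aU)
  have u: "real (total_degree aU) = sum mu (- C)"
  proof -
    have "real (total_degree aU) = (\<Sum>i\<in>UNIV. if i \<in> - C then mu i else 0)"
      unfolding total_degree_def aU of_nat_sum by (intro sum.cong) (auto simp: a_unc)
    then show ?thesis by (simp add: sum.If_cases Compl_eq)
  qed
  have mu_split: "sum mu UNIV = sum mu C + sum mu (- C)"
    using sum.union_disjoint[of C "- C" mu] by (simp add: Compl_partition)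
  have C: "\<forall>i\<in>C. \<exists>j<q. Poly_Mapping.lookup (v j) i \<noteq> 0" by (simp add: C_def)
  obtain y' where y': "\<forall>j<q. 0 \<le> y' j" "(\<Sum>j<q. y' j) = (\<Sum>j<q. y j) + sum mu C"
    "\<forall>i\<in>C. mu i + (\<Sum>j<q. real (Poly_Mapping.lookup (v j) i) * y j) \<le> (\<Sum>j<q. real (Poly_Mapping.lookup (v j) i) * y' j)"
    by (rule absorb_units[of mu q y C "\<lambda>i j. Poly_Mapping.lookup (v j) i", OF mu y C])
  define \<alpha> where "\<alpha> i = int (Poly_Mapping.lookup aC i)" for i
  have nn: "0 \<le> (\<Sum>j<q. real (Poly_Mapping.lookup (v j) i) * y' j)" for i
    by (intro sum_nonneg mult_nonneg_nonneg) (use y'(1) in auto)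
  have cov: "covers q (incidence_matrix v) \<alpha> y'"
    unfolding covers_incidence_matrix_iff using y'(1,3) nn a by (auto simp: \<alpha>_def aC)
  obtain m0 where m0: "m0 \<in> real_values q (incidence_matrix v) \<alpha>"
    "\<And>r. r \<in> real_values q (incidence_matrix v) \<alpha> \<Longrightarrow> m0 \<le> r"
    using covers_attains_minimum[OF cov] by blast
  have least: "(LEAST r. r \<in> real_values q (incidence_matrix v) \<alpha>) = m0"
    by (rule Least_equality) (use m0 in auto)
  let ?N = "LEAST n. n \<in> integer_values q (incidence_matrix v) \<alpha>"
  have "\<lceil>m0\<rceil> = int ?N"
    using round m0 unfolding integer_rounding_def least[symmetric] by blast
  moreover have "m0 \<le> (\<Sum>j<q. y' j)" using m0(2) cov unfolding real_values_def by blast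
  then have "m0 \<le> real_of_int (int b - int (total_degree aU))" using y'(2) b u mu_split by simp
  then have "\<lceil>m0\<rceil> \<le> int b - int (total_degree aU)" by (simp only: ceiling_le_iff)
  ultimately have N: "int ?N \<le> int b - int (total_degree aU)" by simp
  \<comment> \<open>The integer program is feasible, so that its \<open>LEAST\<close> value is attained.\<close>
  have "covers q (incidence_matrix v) \<alpha> (\<lambda>j. real (nat \<lceil>y' j\<rceil>))"
    unfolding covers_incidence_matrix_iff
  proof (intro conjI allI impI)
    fix i
    have "real_of_int (\<alpha> i) \<le> (\<Sum>j<q. real (Poly_Mapping.lookup (v j) i) * y' j)"
      using cov by (simp add: covers_incidence_matrix_iff)
    also have "\<dots> \<le> (\<Sum>j<q. real (Poly_Mapping.lookup (v j) i) * real (nat \<lceil>y' j\<rceil>))"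
      by (intro sum_mono mult_left_mono real_nat_ceiling_ge) auto
    finally show "real_of_int (\<alpha> i) \<le> (\<Sum>j<q. real (Poly_Mapping.lookup (v j) i) * real (nat \<lceil>y' j\<rceil>))" .
  qed auto
  then have "(\<Sum>j<q. nat \<lceil>y' j\<rceil>) \<in> integer_values q (incidence_matrix v) \<alpha>"
    unfolding integer_values_def mem_Collect_eq by (intro exI[of _ "\<lambda>j. nat \<lceil>y' j\<rceil>"] conjI) simp_all
  then have "?N \<in> integer_values q (incidence_matrix v) \<alpha>" by (rule LeastI)
  then obtain z where z: "?N = (\<Sum>j<q. z j)" "covers q (incidence_matrix v) \<alpha> (\<lambda>j. real (z j))"
    by (auto simp: integer_values_def)
  have "(aC, b - total_degree aU) \<in> lattice_monoid q v"
  proof (rule lattice_monoid_if_covered[OF deg])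
    show "(\<Sum>j<q. z j) \<le> b - total_degree aU" using N unfolding z(1) by linarith
    fix i
    have "real_of_int (\<alpha> i) \<le> (\<Sum>j<q. real (Poly_Mapping.lookup (v j) i) * real (z j))"
      using z(2) by (simp add: covers_incidence_matrix_iff)
    then have "real (Poly_Mapping.lookup aC i) \<le> real (\<Sum>j<q. Poly_Mapping.lookup (v j) i * z j)"
      by (simp add: \<alpha>_def)
    then show "Poly_Mapping.lookup aC i \<le> (\<Sum>j<q. Poly_Mapping.lookup (v j) i * z j)"
      by (simp only: of_nat_le_iff)
  qed
  moreover have "(aU, total_degree aU) \<in> lattice_monoid q v"
    by (intro total_degree_level_in_height_one_monoid finite_generators generators_mem)
  ultimately have "(aC, b - total_degree aU) + (aU, total_degree aU) \<in> lattice_monoid q v"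
    using submonoid_height_one_monoid[OF finite_generators] unfolding add_submonoid_def by blast
  moreover have "(aC, b - total_degree aU) + (aU, total_degree aU) = m"
    using N unfolding ab split by simp
  ultimately show "m \<in> lattice_monoid q v" by simp
qed

text \<open>
  An optimal real solution for \<open>\<alpha>\<close> with value \<open>m\<close> puts the positive part \<open>a\<close> of \<open>\<alpha>\<close> into the cone at height
  \<open>\<lceil>m\<rceil>\<close>.  If \<open>(a, \<lceil>m\<rceil>)\<close> is a natural combination of generators, absorbing the units in it
  yields an integral solution of value at most \<open>\<lceil>m\<rceil>\<close>.
\<close>

lemma cone_subset_lattice_imp_integer_rounding:
  fixes v :: "nat \<Rightarrow> ('n::finite \<Rightarrow>\<^sub>0 nat)"
  assumes deg: "\<forall>j<q. total_degree (v j) = 2" and inj: "inj_on v {..<q}"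
    and sub: "cone_monoid q v \<subseteq> lattice_monoid q v"
  shows "integer_rounding q (incidence_matrix v)"
  unfolding integer_rounding_def
proof (intro allI impI)
  fix \<alpha> :: "'n \<Rightarrow> int"
  let ?R = "real_values q (incidence_matrix v) \<alpha>" and ?I = "integer_values q (incidence_matrix v) \<alpha>"
  assume "\<exists>m\<in>?R. \<forall>r\<in>?R. m \<le> r"
  then obtain m where m: "m \<in> ?R" "\<And>r. r \<in> ?R \<Longrightarrow> m \<le> r" by blast
  have least: "(LEAST r. r \<in> ?R) = m"
    by (rule Least_equality) (use m in auto)
  obtain y where y: "m = (\<Sum>j<q. y j)" "\<forall>j<q. 0 \<le> y j"
    "\<And>i. real_of_int (\<alpha> i) \<le> (\<Sum>j<q. real (Poly_Mapping.lookup (v j) i) * y j)"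
    using m(1) by (auto simp: real_values_def covers_incidence_matrix_iff)
  have m_nn: "0 \<le> m" unfolding y(1) by (intro sum_nonneg) (use y(2) in auto)
  define b where "b = nat \<lceil>m\<rceil>"
  have b: "int b = \<lceil>m\<rceil>" using m_nn by (simp add: b_def)
  define a :: "'n \<Rightarrow>\<^sub>0 nat" where "a = (\<Sum>i\<in>UNIV. Poly_Mapping.single i (nat (\<alpha> i)))"
  have a: "Poly_Mapping.lookup a i = nat (\<alpha> i)" for i
  proof -
    have "Poly_Mapping.lookup a i = (\<Sum>k\<in>UNIV. if k = i then nat (\<alpha> i) else 0)"
      unfolding a_def lookup_sum by (intro sum.cong) (auto simp: lookup_single when_def)
    then show ?thesis by simp
  qed
  have nn: "0 \<le> (\<Sum>j<q. real (Poly_Mapping.lookup (v j) i) * y j)" for i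
    by (intro sum_nonneg mult_nonneg_nonneg) (use y(2) in auto)
  have ay: "real (Poly_Mapping.lookup a i) \<le> (\<Sum>j<q. real (Poly_Mapping.lookup (v j) i) * y j)" for i
    using y(3)[of i] nn[of i] by (cases "0 \<le> \<alpha> i") (auto simp: a)
  have "(a, b) \<in> cone_monoid q v"
    by (rule cone_monoid_if_covered[OF deg y(2) _ ay]) (use b y(1) in linarith)+
  then have "(a, b) \<in> lattice_monoid q v" using sub by blast
  obtain n z where nz:
    "\<forall>i. Poly_Mapping.lookup a i = n i + (\<Sum>j<q. Poly_Mapping.lookup (v j) i * z j)"
    "sum n UNIV + (\<Sum>j<q. z j) \<le> b"
    by (rule lattice_monoid_coeffs[OF deg inj \<open>(a, b) \<in> lattice_monoid q v\<close>])
  define C where "C = {i. \<exists>j<q. Poly_Mapping.lookup (v j) i \<noteq> 0}"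
  \<comment> \<open>Coordinates that no \<open>v\<^sub>j\<close> involves carry no unit, because they vanish in \<open>a\<close>.\<close>
  have n0: "n i = 0" if "i \<notin> C" for i
  proof -
    have "(\<Sum>j<q. real (Poly_Mapping.lookup (v j) i) * y j) = 0" using that by (simp add: C_def)
    then show ?thesis using ay[of i] spec[OF nz(1), of i] by (simp del: of_nat_add of_nat_sum of_nat_mult)
  qed
  have C: "\<forall>i\<in>C. \<exists>j<q. Poly_Mapping.lookup (v j) i \<noteq> 0" by (simp add: C_def)
  obtain z' :: "nat \<Rightarrow> nat" where z': "(\<Sum>j<q. z' j) = (\<Sum>j<q. z j) + sum n C"
    "\<forall>i. (\<Sum>j<q. Poly_Mapping.lookup (v j) i * z j) \<le> (\<Sum>j<q. Poly_Mapping.lookup (v j) i * z' j)"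
    "\<forall>i\<in>C. n i + (\<Sum>j<q. Poly_Mapping.lookup (v j) i * z j) \<le> (\<Sum>j<q. Poly_Mapping.lookup (v j) i * z' j)"
    by (rule absorb_units[of n q z C "\<lambda>i j. Poly_Mapping.lookup (v j) i", OF _ _ C, unfolded of_nat_id]) simp_all
  have "sum n C \<le> sum n UNIV" by (intro sum_mono2) auto
  then have z'b: "(\<Sum>j<q. z' j) \<le> b" using z'(1) nz(2) by simp
  have az: "Poly_Mapping.lookup a i \<le> (\<Sum>j<q. Poly_Mapping.lookup (v j) i * z' j)" for i
    using z'(2,3) n0[of i] nz(1) by (cases "i \<in> C") auto
  have cov: "covers q (incidence_matrix v) \<alpha> (\<lambda>j. real (z' j))"
    unfolding covers_incidence_matrix_iff
  proof (intro conjI allI impI)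
    fix i
    have "\<alpha> i \<le> int (Poly_Mapping.lookup a i)" by (simp add: a)
    then have "real_of_int (\<alpha> i) \<le> real (Poly_Mapping.lookup a i)" by linarith
    also have "\<dots> \<le> real (\<Sum>j<q. Poly_Mapping.lookup (v j) i * z' j)" using az by (simp only: of_nat_le_iff)
    finally show "real_of_int (\<alpha> i) \<le> (\<Sum>j<q. real (Poly_Mapping.lookup (v j) i) * real (z' j))" by simp
  qed auto
  then have z'I: "(\<Sum>j<q. z' j) \<in> ?I" unfolding integer_values_def by blast
  let ?N = "LEAST n. n \<in> ?I"
  have "?N \<in> ?I" using z'I by (rule LeastI)
  then obtain w where w: "?N = (\<Sum>j<q. w j)" "covers q (incidence_matrix v) \<alpha> (\<lambda>j. real (w j))"
    by (auto simp: integer_values_def)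
  have "real ?N \<in> ?R" unfolding real_values_def mem_Collect_eq
    by (intro exI[of _ "\<lambda>j. real (w j)"]) (use w in auto)
  then have "m \<le> real_of_int (int ?N)" using m(2) by simp
  then have "\<lceil>m\<rceil> \<le> int ?N" by (simp only: ceiling_le_iff)
  moreover have "?N \<le> b" using Least_le[of "\<lambda>n. n \<in> ?I", OF z'I] z'b by linarith
  then have "int ?N \<le> \<lceil>m\<rceil>" using b by linarith
  ultimately show "\<lceil>LEAST r. r \<in> ?R\<rceil> = int ?N" unfolding least by simp
qed

lemma semigroup_ring_eq:
  fixes v :: "nat \<Rightarrow> ('n::{finite,linorder} \<Rightarrow>\<^sub>0 nat)"
  shows "(semigroup_ring (nat_combinations (\<B> q v)) :: ('n, 'k::field) mpoly poly set) = monoid_ring (lattice_monoid q v)"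
proof -
  have "(a, b) \<in> lattice_monoid q v \<longleftrightarrow> (vec_of a, real b) \<in> nat_combinations (\<B> q v)" for a b
    by (simp add: height_one_monoid_def nat_exp_def \<B>_eq)
  then show ?thesis
    unfolding semigroup_ring_def K_adjoin_monz_eq_monoid_ring[OF submonoid_height_one_monoid[OF finite_generators], symmetric]
    by simp
qed

lemma ehrhart_ring_eq:
  fixes P :: "(real ^ 'n::{finite,linorder}) set"
  assumes "convex P" "P \<noteq> {}"
  shows "(ehrhart_ring P :: ('n, 'k::field) mpoly poly set) = monoid_ring (ehrhart_exponents P)"
  unfolding ehrhart_ring_def K_adjoin_monz_eq_monoid_ring[OF submonoid_ehrhart_exponents[OF assms], symmetric]
  by (simp add: ehrhart_exponents_def)

theorem theorem4p4:
  fixes I :: "('n::{finite,linorder}, 'k::field) mpoly set"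
    and v :: "nat \<Rightarrow> ('n \<Rightarrow>\<^sub>0 nat)"
    and q :: nat
  assumes "\<exists>D. (\<forall>a\<in>D. total_degree a = 2) \<and> I = ideal_gen (mon ` D)"
    and "inj_on v {..<q}"
    and "minimal_monomial_generators I ((\<lambda>j. mon (v j)) ` {..<q})"
  shows "integral_closure (semigroup_ring (nat_combinations (\<B> q v)) :: ('n, 'k) mpoly poly set)
           = to_fract ` (ehrhart_ring (\<Q> q v) :: ('n, 'k) mpoly poly set)
         \<and> ((semigroup_ring (nat_combinations (\<B> q v)) :: ('n, 'k) mpoly poly set)
               = ehrhart_ring (\<Q> q v)
             \<longleftrightarrow> integer_rounding q (incidence_matrix v))"
proof -
  obtain D where D: "\<forall>a\<in>D. total_degree a = 2" "I = ideal_gen (mon ` D)" using assms(1) by blast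
  have "minimal_monomial_generators I (mon ` (v ` {..<q}))" using assms(3) by (simp add: image_image)
  then have "v ` {..<q} \<subseteq> D" by (rule minimal_monomial_generators_subset[OF D(2)])
  then have deg: "\<forall>j<q. total_degree (v j) = 2" using D(1) by blast
  have "convex (\<Q> q v)" "\<Q> q v \<noteq> {}" by (auto simp: \<Q>_def convex_convex_hull)
  note E = ehrhart_ring_eq[OF this, where 'k='k]
  note R = semigroup_ring_eq[of q v, where 'k='k]
  have "lattice_monoid q v \<subseteq> cone_monoid q v"
    unfolding \<Q>_eq by (rule height_one_monoid_subset_ehrhart[OF finite_generators]) (use generators_mem(1)[of q v] in blast)
  then have "lattice_monoid q v = cone_monoid q v \<longleftrightarrow> integer_rounding q (incidence_matrix v)"
    using integer_rounding_imp_cone_subset_lattice[OF deg assms(2)]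
      cone_subset_lattice_imp_integer_rounding[OF deg assms(2)] by blast
  moreover have "integral_closure (monoid_ring (lattice_monoid q v) :: ('n, 'k) mpoly poly set) = to_fract ` monoid_ring (cone_monoid q v)"
    unfolding \<Q>_eq by (intro integral_closure_height_one_monoid_ring finite_generators generators_mem)
  ultimately show ?thesis unfolding E R monoid_ring_eq_iff by blast
qed

end
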